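(* For any $\eta>0$ satisfying $$\eta\ge\frac{8C_\sharp\sigma_{\max}^2(1+\epsilon^{-2}+\epsilon^{-4})}{M}$$ and any $\delta>0$, if $D=T_1+\cdots+T_M$ satisfies $$D\ge\frac{8\sigma_{\max}^2(1+\epsilon^{-2}+\epsilon^{-4})}{c_0\eta}\log\left(\frac{ML}{\delta}\right),$$ then $$\mathbb P\left[\frac2D\mathcal N_\star(X^\top\boldsymbol U)\ge\frac{3\eta}{2\sqrt L}\right]\le\delta.$$
   Context: Model. $M\ge1$ and $L\ge L_0\ge1$ are integers, $[n]=\{1,\dots,n\}$, $\epsilon\in(0,1)$. For $m\in[M]$, $\{X^m_t\}_{t\in\mathbb Z}$ is a stationary univariate autoregressive process $X^m_t=\sum_{l=1}^{L}\beta^m_lX^m_{t-l}+U^m_t$, where all $M$ processes have the same true lag $L_0$ (so $\beta^m_{L_0}\neq0$ and $\beta^m_l=0$ for $l>L_0$). The innovations $U^m_t$ ($m\in[M]$, $t\in\mathbb Z$) are independent mean-zero Gaussians, $U^m_t$ having standard deviation $\sigma_m\in(0,\infty)$. Each process is $\epsilon$-stable: $f_m(z)=1-\sum_{l=1}^L\beta^m_lz^l$ has no zero in $|z|\le1$ and $\epsilon\le\min_{|z|=1}|f_m(z)|\le\max_{|z|=1}|f_m(z)|\le\epsilon^{-1}$. Data. From the $m$-th process one observes $L+T_m$ consecutive samples $X^m_t$, $t=1-L,\dots,T_m$. $T_{\min}=\min_mT_m$, $T_{\max}=\max_mT_m$, $C_\sharp=T_{\max}/T_{\min}$, $\sigma_{\max}=\max_m\sigma_m$.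 $X_m$ is the $T_m\times L$ matrix with $(t,l)$ entry $X^m_{t-l}$; $X\in\mathbb R^{D\times ML}$ is block-diagonal with blocks $X_1,\dots,X_M$; $\boldsymbol U=(U^1_1,\dots,U^1_{T_1},\dots,U^M_1,\dots,U^M_{T_M})^\top$. Group norm. For $\boldsymbol\alpha=(\alpha^m_l)\in\mathbb R^{ML}$, $\mathcal N(\boldsymbol\alpha)=\sum_{l=1}^L\sqrt{M(L-l+1)}\,\big(\sum_{m=1}^M\sum_{j=l}^L|\alpha^m_j|^2\big)^{1/2}$, with dual norm $\mathcal N_\star(\boldsymbol\alpha)=\max\{\langle\boldsymbol\alpha,\boldsymbol\gamma\rangle:\mathcal N(\boldsymbol\gamma)\le1\}$. Constant. $c_0>0$ is the absolute constant of the following Gaussian concentration inequality: if $\boldsymbol q\sim N(\boldsymbol 0,\Sigma)$ in $\mathbb R^d$ with $\Sigma$ symmetric positive definite, then for all $\tau>0$, $\mathbb P[\frac1d|\boldsymbol q^\top\boldsymbol q-\operatorname{tr}(\Sigma)|\ge4\tau\|\Sigma\|_{\mathrm{op}}]\le2e^{-c_0d\min\{\tau^2,\tau\}}$. *)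

theory Defs
  imports "HOL-Probability.Probability"
begin

text \<open>Strict stationarity, stated for the law of the whole trajectory on the product
  sigma-algebra; this is the same as shift invariance of all finite-dimensional laws.\<close>

definition stationary_process :: "'a measure \<Rightarrow> (int \<Rightarrow> 'a \<Rightarrow> real) \<Rightarrow> bool" where
  "stationary_process P x \<longleftrightarrow>
     (\<forall>t. x t \<in> borel_measurable P) \<and>
     (\<forall>h. distr P (\<Pi>\<^sub>M t\<in>UNIV. borel) (\<lambda>\<omega> t. x (t + h) \<omega>) =
          distr P (\<Pi>\<^sub>M t\<in>UNIV. borel) (\<lambda>\<omega> t. x t \<omega>))"

definition ar_process ::
  "'a measure \<Rightarrow> nat \<Rightarrow> (nat \<Rightarrow> real) \<Rightarrow> (int \<Rightarrow> 'a \<Rightarrow> real) \<Rightarrow> (int \<Rightarrow> 'a \<Rightarrow> real) \<Rightarrow> bool" where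
  "ar_process P L b u x \<longleftrightarrow>
     stationary_process P x \<and>
     (\<forall>t. AE \<omega> in P. x t \<omega> = (\<Sum>l=1..L. b l * x (t - int l) \<omega>) + u t \<omega>)"

definition ar_poly :: "nat \<Rightarrow> (nat \<Rightarrow> real) \<Rightarrow> complex \<Rightarrow> complex" where
  "ar_poly L b z = 1 - (\<Sum>l=1..L. of_real (b l) * z ^ l)"

definition eps_stable :: "real \<Rightarrow> nat \<Rightarrow> (nat \<Rightarrow> real) \<Rightarrow> bool" where
  "eps_stable \<epsilon> L b \<longleftrightarrow>
     (\<forall>z. cmod z \<le> 1 \<longrightarrow> ar_poly L b z \<noteq> 0) \<and>
     \<epsilon> \<le> (INF z\<in>sphere 0 1. cmod (ar_poly L b z)) \<and>
     (SUP z\<in>sphere 0 1. cmod (ar_poly L b z)) \<le> inverse \<epsilon>"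

text \<open>Rows of the block-diagonal matrix are indexed by pairs (process, time), columns by pairs
  (process, lag); a vector with entries \<open>\<alpha>\<^sup>m\<^sub>l\<close> is a function \<open>\<alpha>\<close> of \<open>m\<close> and \<open>l\<close>, of which only
  the values with \<open>1 \<le> m \<le> M\<close> and \<open>1 \<le> l \<le> L\<close> matter.\<close>

definition sample_index :: "nat \<Rightarrow> (nat \<Rightarrow> nat) \<Rightarrow> (nat \<times> nat) set" where
  "sample_index M T = (SIGMA m:{1..M}. {1..T m})"

definition lag_matrix :: "(int \<Rightarrow> real) \<Rightarrow> nat \<Rightarrow> nat \<Rightarrow> real" where
  "lag_matrix x t l = x (int t - int l)"

definition design_matrix ::
  "(nat \<Rightarrow> int \<Rightarrow> 'a \<Rightarrow> real) \<Rightarrow> 'a \<Rightarrow> nat \<times> nat \<Rightarrow> nat \<times> nat \<Rightarrow> real" where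
  "design_matrix X \<omega> = (\<lambda>(m, t) (m', l). if m = m' then lag_matrix (\<lambda>s. X m s \<omega>) t l else 0)"

definition noise_vector :: "(nat \<Rightarrow> int \<Rightarrow> 'a \<Rightarrow> real) \<Rightarrow> 'a \<Rightarrow> nat \<times> nat \<Rightarrow> real" where
  "noise_vector U \<omega> = (\<lambda>(m, t). U m (int t) \<omega>)"

definition transpose_mult ::
  "'r set \<Rightarrow> ('r \<Rightarrow> nat \<times> nat \<Rightarrow> real) \<Rightarrow> ('r \<Rightarrow> real) \<Rightarrow> nat \<Rightarrow> nat \<Rightarrow> real" where
  "transpose_mult R A v = (\<lambda>m l. \<Sum>r\<in>R. A r (m, l) * v r)"

definition group_norm :: "nat \<Rightarrow> nat \<Rightarrow> (nat \<Rightarrow> nat \<Rightarrow> real) \<Rightarrow> real" where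
  "group_norm M L \<alpha> =
     (\<Sum>l=1..L. sqrt (real M * real (L - l + 1)) * sqrt (\<Sum>m=1..M. \<Sum>j=l..L. \<bar>\<alpha> m j\<bar>\<^sup>2))"

text \<open>The supremum is a maximum: the \<open>group_norm\<close> unit ball of \<open>\<real>\<^bsup>ML\<^esup>\<close> is compact.\<close>

definition dual_group_norm :: "nat \<Rightarrow> nat \<Rightarrow> (nat \<Rightarrow> nat \<Rightarrow> real) \<Rightarrow> real" where
  "dual_group_norm M L \<alpha> =
     Sup {(\<Sum>m=1..M. \<Sum>l=1..L. \<alpha> m l * \<gamma> m l) | \<gamma>. group_norm M L \<gamma> \<le> 1}"

text \<open>Vectors and matrices of a varying dimension \<open>d\<close> are functions on \<open>{1..d}\<close>.\<close>

definition sym_pos_def :: "nat \<Rightarrow> (nat \<Rightarrow> nat \<Rightarrow> real) \<Rightarrow> bool" where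
  "sym_pos_def d S \<longleftrightarrow>
     (\<forall>i\<in>{1..d}. \<forall>j\<in>{1..d}. S i j = S j i) \<and>
     (\<forall>a. (\<exists>i\<in>{1..d}. a i \<noteq> 0) \<longrightarrow> 0 < (\<Sum>i=1..d. \<Sum>j=1..d. a i * S i j * a j))"

definition op_norm :: "nat \<Rightarrow> (nat \<Rightarrow> nat \<Rightarrow> real) \<Rightarrow> real" where
  "op_norm d S =
     Sup {L2_set (\<lambda>i. \<Sum>j=1..d. S i j * a j) {1..d} | a. L2_set a {1..d} \<le> 1}"

text \<open>The law \<open>\<nu>\<close> is \<open>N(0,S)\<close>, for \<open>S\<close> positive definite: every nontrivial linear functional \<open>a\<close> of
  the vector is univariate normal with mean \<open>0\<close> and variance \<open>a\<^sup>T S a\<close>.\<close>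

definition centred_gaussian :: "nat \<Rightarrow> (nat \<Rightarrow> nat \<Rightarrow> real) \<Rightarrow> (nat \<Rightarrow> real) measure \<Rightarrow> bool" where
  "centred_gaussian d S \<nu> \<longleftrightarrow>
     prob_space \<nu> \<and>
     sets \<nu> = sets (\<Pi>\<^sub>M i\<in>{1..d}. (borel :: real measure)) \<and>
     (\<forall>a. (\<exists>i\<in>{1..d}. a i \<noteq> 0) \<longrightarrow>
        distributed \<nu> lborel (\<lambda>q. \<Sum>i=1..d. a i * q i)
          (normal_density 0 (sqrt (\<Sum>i=1..d. \<Sum>j=1..d. a i * S i j * a j))))"

definition gaussian_concentration_constant :: "real \<Rightarrow> bool" where
  "gaussian_concentration_constant c \<longleftrightarrow> 0 < c \<and>
     (\<forall>d\<ge>1. \<forall>S \<nu>. \<forall>\<tau>>0. sym_pos_def d S \<longrightarrow> centred_gaussian d S \<nu> \<longrightarrow>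
        measure \<nu> {q \<in> space \<nu>.
            1 / real d * \<bar>(\<Sum>i=1..d. q i * q i) - (\<Sum>i=1..d. S i i)\<bar> \<ge> 4 * \<tau> * op_norm d S}
          \<le> 2 * exp (- c * real d * min (\<tau>\<^sup>2) \<tau>))"

end

theory Submission
  imports Defs "HOL-Complex_Analysis.Complex_Analysis"
begin

text \<open>
  By a Stechkin-type inequality \<open>\<N>\<^sub>\<star>(v) \<le> 2 L\<^sup>-\<^sup>1\<^sup>/\<^sup>2 max \<bar>v\<^sup>m\<^sub>l\<bar>\<close>, so it suffices to bound the
  tails of the \<open>M L\<close> sums \<open>\<Sum>\<^sub>t X\<^sup>m\<^sub>t\<^sub>-\<^sub>l U\<^sup>m\<^sub>t\<close> at the level \<open>a = 3 \<eta> D / 8\<close>. The assumption on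
  \<open>\<eta>\<close> makes \<open>a\<close> a large multiple of \<open>T\<^sub>m \<sigma>\<^sup>2\<close>, so cancellation between \<open>X\<close> and \<open>U\<close> is not needed:
  \<open>2 \<bar>X U\<bar> \<le> \<epsilon> X\<^sup>2 + U\<^sup>2 / \<epsilon>\<close>, and the exponential moments of both sums of squares are bounded
  by Gaussian linearisation, as \<open>X\<close> has covariance at most \<open>\<sigma>\<^sup>2 / \<epsilon>\<^sup>2\<close> by Parseval.

  With \<open>y = D \<eta> / (8 \<sigma>\<^sub>m\<^sub>a\<^sub>x\<^sup>2 (1 + \<epsilon>\<^sup>-\<^sup>2 + \<epsilon>\<^sup>-\<^sup>4))\<close> each tail is at most \<open>exp (- 19 y / 8)\<close>. The
  assumption on \<open>D\<close> says \<open>M L exp (- c\<^sub>0 y) \<le> \<delta>\<close>. The concentration inequality itself would give a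
  union bound with a spurious factor in front of \<open>\<delta>\<close>; it is used only through its consequence
  \<open>c\<^sub>0 \<le> 9 / 4\<close>, obtained by testing it on a single standard normal variable.
\<close>

section \<open>The dual group norm against the largest entry\<close>

text \<open>The integers in \<open>(j/2, j]\<close> number at least \<open>j/2\<close>, and each
  reciprocal is at least \<open>1/j\<close>. They label the blocks \<open>l \<le> j < 2l\<close>
  that contain \<open>j\<close>, so weighting block sums by \<open>1/l\<close> counts every index at
  least half.\<close>

lemma sum_inverse_upper_half_ge:
  fixes j L :: nat
  assumes "1 \<le> j" "j \<le> L"
  shows "1 / 2 \<le> (\<Sum>l | l \<in> {1..L} \<and> l \<le> j \<and> j < 2 * l. 1 / real l)"
proof -
  let ?A = "{l \<in> {1..L}. l \<le> j \<and> j < 2 * l}"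
  have A: "?A = {j div 2 + 1..j}"
    using assms by auto
  have "1 / 2 \<le> (\<Sum>l\<in>?A. 1 / real j)"
  proof -
    have "real j / 2 \<le> real (j - j div 2)" by linarith
    then show ?thesis unfolding A using assms by (simp add: field_simps)
  qed
  also have "\<dots> \<le> (\<Sum>l\<in>?A. 1 / real l)"
    using assms by (intro sum_mono) (auto simp: field_simps)
  finally show ?thesis by simp
qed

lemma sum_le_card_L2:
  fixes g :: "nat \<Rightarrow> real"
  assumes "finite A" "card A \<le> n"
  shows "(\<Sum>j\<in>A. g j) \<le> sqrt (real n) * sqrt (\<Sum>j\<in>A. (g j)\<^sup>2)"
proof -
  have "(\<Sum>j\<in>A. g j)\<^sup>2 \<le> real (card A) * (\<Sum>j\<in>A. (g j)\<^sup>2)"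
    using Cauchy_Schwarz_ineq_sum[of "\<lambda>_. 1" g A] by simp
  also have "\<dots> \<le> real n * (\<Sum>j\<in>A. (g j)\<^sup>2)"
    using assms by (intro mult_right_mono sum_nonneg) auto
  finally show ?thesis
    by (metis real_le_rsqrt real_sqrt_mult)
qed

text \<open>A form of Stechkin's inequality with the non-optimal constant 2: the tail from \<open>l\<close> is
  compared with the block \<open>l \<le> j < 2l\<close>, and \<open>l (L - l + 1) \<ge> L\<close>.\<close>

lemma sum_le_weighted_tails:
  fixes g :: "nat \<Rightarrow> real"
  assumes g: "\<And>j. 0 \<le> g j"
  shows "sqrt (real L) * (\<Sum>j=1..L. g j)
           \<le> 2 * (\<Sum>l=1..L. sqrt (real (L - l + 1)) * sqrt (\<Sum>j=l..L. (g j)\<^sup>2))"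
proof -
  have block: "sqrt (real L) * (1 / real l * (\<Sum>j | j \<in> {1..L} \<and> l \<le> j \<and> j < 2 * l. g j))
      \<le> sqrt (real (L - l + 1)) * sqrt (\<Sum>j=l..L. (g j)\<^sup>2)" if l: "l \<in> {1..L}" for l
  proof -
    let ?B = "{j \<in> {1..L}. l \<le> j \<and> j < 2 * l}"
    have "card ?B \<le> card {l..<2*l}" by (intro card_mono) auto
    then have "(\<Sum>j\<in>?B. g j) \<le> sqrt (real l) * sqrt (\<Sum>j\<in>?B. (g j)\<^sup>2)"
      by (intro sum_le_card_L2) auto
    also have "\<dots> \<le> sqrt (real l) * sqrt (\<Sum>j=l..L. (g j)\<^sup>2)"
      using l by (intro mult_left_mono real_sqrt_le_mono sum_mono2) auto
    finally have *: "(\<Sum>j\<in>?B. g j) \<le> sqrt (real l) * sqrt (\<Sum>j=l..L. (g j)\<^sup>2)" .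
    \<comment> \<open>Expanded, this is \<open>L \<le> l * (L - l + 1)\<close>. The block weight
      \<open>1 / l\<close> and Cauchy-Schwarz leave the factor \<open>sqrt (L / l)\<close>, which is
      therefore at most the weight of the tail from \<open>l\<close>.\<close>
    have "0 \<le> (real l - 1) * (real L - real l)" using l by auto
    then have "real L \<le> real l * real (L - l + 1)"
      using l by (simp add: of_nat_diff algebra_simps)
    then have **: "sqrt (real L) \<le> sqrt (real l) * sqrt (real (L - l + 1))"
      by (metis real_sqrt_le_mono real_sqrt_mult)
    have "sqrt (real L) * (1 / real l * (\<Sum>j\<in>?B. g j))
        \<le> (sqrt (real l) * sqrt (real (L - l + 1)))
            * (1 / real l * (sqrt (real l) * sqrt (\<Sum>j=l..L. (g j)\<^sup>2)))"
      using * ** l by (intro mult_mono mult_nonneg_nonneg sum_nonneg g) simp_all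
    also have "\<dots> = sqrt (real (L - l + 1)) * sqrt (\<Sum>j=l..L. (g j)\<^sup>2)"
      using l by (simp add: field_simps)
    finally show ?thesis .
  qed
  have "(\<Sum>j=1..L. g j) = 2 * (\<Sum>j=1..L. g j * (1 / 2))"
    by (simp add: sum_distrib_left)
  also have "\<dots> \<le> 2 * (\<Sum>j=1..L. g j * (\<Sum>l | l \<in> {1..L} \<and> l \<le> j \<and> j < 2 * l. 1 / real l))"
    using g sum_inverse_upper_half_ge by (intro mult_left_mono sum_mono) auto
  also have "(\<Sum>j=1..L. g j * (\<Sum>l | l \<in> {1..L} \<and> l \<le> j \<and> j < 2 * l. 1 / real l))
     = (\<Sum>l=1..L. 1 / real l * (\<Sum>j | j \<in> {1..L} \<and> l \<le> j \<and> j < 2 * l. g j))"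
    unfolding sum_distrib_left by (subst sum.swap_restrict) (auto simp: mult_ac)
  finally have "sqrt (real L) * (\<Sum>j=1..L. g j)
      \<le> sqrt (real L) * (2 * (\<Sum>l=1..L. 1 / real l * (\<Sum>j | j \<in> {1..L} \<and> l \<le> j \<and> j < 2 * l. g j)))"
    by (intro mult_left_mono) auto
  also have "\<dots> = 2 * (\<Sum>l=1..L. sqrt (real L) * (1 / real l * (\<Sum>j | j \<in> {1..L} \<and> l \<le> j \<and> j < 2 * l. g j)))"
    by (simp add: sum_distrib_left mult_ac)
  also have "\<dots> \<le> 2 * (\<Sum>l=1..L. sqrt (real (L - l + 1)) * sqrt (\<Sum>j=l..L. (g j)\<^sup>2))"
    by (intro mult_left_mono sum_mono block) auto
  finally show ?thesis .
qed

text \<open>Bounding the entries by \<open>B\<close> and applying Cauchy-Schwarz over the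
  \<open>M\<close> processes at each lag reduces the pairing to the column norms \<open>g l\<close>.
  Their squared tails are those inside the group norm, so the weighted tail inequality applies to
  \<open>g\<close>; it yields the factor 2 and the gain \<open>1 / sqrt L\<close>.\<close>

lemma dual_group_norm_le:
  assumes L: "1 \<le> L"
    and v: "\<And>m l. m \<in> {1..M} \<Longrightarrow> l \<in> {1..L} \<Longrightarrow> \<bar>v m l\<bar> \<le> B"
    and B: "0 \<le> B"
  shows "dual_group_norm M L v \<le> 2 * B / sqrt (real L)"
  unfolding dual_group_norm_def
proof (rule cSup_least)
  show "{(\<Sum>m=1..M. \<Sum>l=1..L. v m l * \<gamma> m l) | \<gamma>. group_norm M L \<gamma> \<le> 1} \<noteq> {}"
    by (auto intro!: exI[of _ "\<lambda>_ _. 0"] simp: group_norm_def)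
next
  fix x assume "x \<in> {(\<Sum>m=1..M. \<Sum>l=1..L. v m l * \<gamma> m l) | \<gamma>. group_norm M L \<gamma> \<le> 1}"
  then obtain \<gamma> where x: "x = (\<Sum>m=1..M. \<Sum>l=1..L. v m l * \<gamma> m l)" and \<gamma>: "group_norm M L \<gamma> \<le> 1"
    by auto
  define g where "g l = sqrt (\<Sum>m=1..M. (\<gamma> m l)\<^sup>2)" for l
  have g0: "0 \<le> g l" for l by (auto simp: g_def intro!: sum_nonneg)
  have "x = (\<Sum>l=1..L. \<Sum>m=1..M. v m l * \<gamma> m l)" unfolding x by (rule sum.swap)
  also have "\<dots> \<le> (\<Sum>l=1..L. B * (sqrt (real M) * g l))"
  proof (rule sum_mono)
    fix l assume l: "l \<in> {1..L}"
    have "(\<Sum>m=1..M. v m l * \<gamma> m l) \<le> (\<Sum>m=1..M. B * \<bar>\<gamma> m l\<bar>)"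
    proof (rule sum_mono)
      fix m assume m: "m \<in> {1..M}"
      have "v m l * \<gamma> m l \<le> \<bar>v m l\<bar> * \<bar>\<gamma> m l\<bar>" by (metis abs_ge_self abs_mult)
      also have "\<dots> \<le> B * \<bar>\<gamma> m l\<bar>" using v[OF m l] by (intro mult_right_mono) auto
      finally show "v m l * \<gamma> m l \<le> B * \<bar>\<gamma> m l\<bar>" .
    qed
    also have "\<dots> = B * (\<Sum>m=1..M. \<bar>\<gamma> m l\<bar>)" by (simp add: sum_distrib_left)
    also have "\<dots> \<le> B * (sqrt (real M) * g l)"
      using sum_le_card_L2[of "{1..M}" M "\<lambda>m. \<bar>\<gamma> m l\<bar>"] B unfolding g_def
      by (intro mult_left_mono) auto
    finally show "(\<Sum>m=1..M. v m l * \<gamma> m l) \<le> B * (sqrt (real M) * g l)" .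
  qed
  also have "\<dots> = B / sqrt (real L) * (sqrt (real M) * (sqrt (real L) * (\<Sum>l=1..L. g l)))"
    using L by (simp add: sum_distrib_left field_simps)
  also have "\<dots> \<le> B / sqrt (real L) * (sqrt (real M) *
      (2 * (\<Sum>l=1..L. sqrt (real (L - l + 1)) * sqrt (\<Sum>j=l..L. (g j)\<^sup>2))))"
    using B by (intro mult_left_mono sum_le_weighted_tails g0) auto
  also have "\<dots> = B / sqrt (real L) * (2 * group_norm M L \<gamma>)"
  proof -
    have "(\<Sum>j=l..L. (g j)\<^sup>2) = (\<Sum>m=1..M. \<Sum>j=l..L. \<bar>\<gamma> m j\<bar>\<^sup>2)" for l
      by (subst sum.swap) (auto simp: g_def intro!: sum.cong sum_nonneg)
    then show ?thesis
      unfolding group_norm_def by (simp add: sum_distrib_left real_sqrt_mult mult_ac)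
  qed
  also have "\<dots> \<le> B / sqrt (real L) * (2 * 1)"
    using \<gamma> B by (intro mult_left_mono) auto
  finally show "x \<le> 2 * B / sqrt (real L)" by (simp add: mult.commute)
qed

section \<open>Parseval on roots of unity and inverse power series\<close>

text \<open>Discrete Parseval: sampling at the \<open>N\<close>-th roots of unity is
  \<open>sqrt N\<close> times a unitary map on coefficient vectors of length \<open>N\<close>, and
  \<open>degree p < N\<close> rules out aliasing. Finite sums thus replace integrals over the
  circle.\<close>

lemma sum_norm_poly_roots_of_unity:
  fixes p :: "complex poly"
  assumes N: "degree p < N"
  shows "(\<Sum>k<N. (cmod (poly p (cis (2 * pi * real k / real N))))\<^sup>2)
           = real N * (\<Sum>i<N. (cmod (coeff p i))\<^sup>2)"
proof -
  define w where "w k = cis (2 * pi * real k / real N)" for k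
  have N0: "N > 0" using N by auto
  \<comment> \<open>The summands are powers of a single \<open>N\<close>-th root of unity
    \<open>z\<close>. Since \<open>\<bar>i - j\<bar> < N\<close>, it differs from 1 unless
    \<open>i = j\<close>, and then its geometric sum vanishes.\<close>
  have ortho: "(\<Sum>k<N. w k ^ i * cnj (w k ^ j)) = (if i = j then of_nat N else 0)"
    if "i < N" "j < N" for i j
  proof -
    define z where "z = cis (2 * pi * (real i - real j) / real N)"
    have wz: "w k ^ i * cnj (w k ^ j) = z ^ k" for k
      unfolding w_def z_def
      by (simp add: Complex.DeMoivre cis_cnj cis_mult) (simp add: field_simps flip: diff_divide_distrib)
    show ?thesis
    proof (cases "i = j")
      case True
      then show ?thesis unfolding wz by (simp add: z_def)
    next
      case False
      have "z \<noteq> 1"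
      proof
        assume "z = 1"
        then have "cos (2 * pi * (real i - real j) / real N) = 1"
          by (simp add: z_def complex_eq_iff)
        then obtain n :: int where "2 * pi * (real i - real j) / real N = n * 2 * pi"
          by (auto simp: cos_one_2pi_int)
        then have "(2 * pi) * (real i - real j) = (2 * pi) * (n * real N)"
        proof -
          assume "2 * pi * (real i - real j) / real N = n * 2 * pi"
          then have "2 * pi * (real i - real j) = n * 2 * pi * real N"
            using N0 by (metis nonzero_divide_eq_eq of_nat_0_less_iff less_irrefl)
          also have "n * 2 * pi * real N = (2 * pi) * (n * real N)" by simp
          finally show ?thesis .
        qed
        then have "real i - real j = n * real N" by simp
        then have "int i - int j = n * int N"
          by (metis of_int_diff of_int_eq_iff of_int_mult of_int_of_nat_eq)
        then have "int N dvd int i - int j" by simp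
        moreover have "\<bar>int i - int j\<bar> < int N" using that by linarith
        ultimately have "int i - int j = 0" using zdvd_imp_le[of "int N" "\<bar>int i - int j\<bar>"] by fastforce
        then show False using False by simp
      qed
      moreover have "z ^ N = 1"
      proof -
        have "real N * (2 * pi * (real i - real j) / real N) = 2 * pi * (real i - real j)"
          using N0 by simp
        then show ?thesis
          unfolding z_def Complex.DeMoivre by (simp add: cis_multiple_2pi)
      qed
      ultimately show ?thesis
        unfolding wz using False by (simp add: sum_gp_strict)
    qed
  qed
  have eval: "poly p x = (\<Sum>i<N. coeff p i * x ^ i)" for x
    unfolding poly_altdef using N
    by (intro sum.mono_neutral_left) (auto simp: coeff_eq_0)
  have "complex_of_real (\<Sum>k<N. (cmod (poly p (w k)))\<^sup>2) = (\<Sum>k<N. poly p (w k) * cnj (poly p (w k)))"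
    by (simp only: of_real_sum complex_norm_square)
  also have "\<dots> = (\<Sum>k<N. \<Sum>i<N. \<Sum>j<N. coeff p i * cnj (coeff p j) * (w k ^ i * cnj (w k ^ j)))"
    unfolding eval cnj_sum sum_product by (intro sum.cong) (auto simp: mult_ac)
  also have "\<dots> = (\<Sum>i<N. \<Sum>k<N. \<Sum>j<N. coeff p i * cnj (coeff p j) * (w k ^ i * cnj (w k ^ j)))"
    by (rule sum.swap)
  also have "\<dots> = (\<Sum>i<N. \<Sum>j<N. \<Sum>k<N. coeff p i * cnj (coeff p j) * (w k ^ i * cnj (w k ^ j)))"
    by (rule sum.cong[OF refl], rule sum.swap)
  also have "\<dots> = (\<Sum>i<N. \<Sum>j<N. coeff p i * cnj (coeff p j) * (if i = j then of_nat N else 0))"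
    by (intro sum.cong refl) (simp only: sum_distrib_left[symmetric] ortho lessThan_iff)
  also have "\<dots> = (\<Sum>i<N. of_nat N * (coeff p i * cnj (coeff p i)))"
    by (intro sum.cong refl) (simp add: if_distrib[where f="\<lambda>x. _ * x"] sum.delta' cong: if_cong)
  also have "\<dots> = complex_of_real (real N * (\<Sum>i<N. (cmod (coeff p i))\<^sup>2))"
    by (simp only: of_real_mult of_real_sum complex_norm_square of_real_of_nat_eq sum_distrib_left)
  finally show ?thesis unfolding w_def of_real_eq_iff .
qed

text \<open>Multiplication by \<open>p\<close> enlarges each sampled value of \<open>q\<close> by a
  factor of at least \<open>\<epsilon>\<close>; Parseval with one \<open>N\<close> common to
  \<open>q\<close> and \<open>p * q\<close> carries this over to the coefficients.\<close>

lemma sum_norm_coeff_mult_ge: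
  fixes p q :: "complex poly"
  assumes p: "\<And>z. cmod z = 1 \<Longrightarrow> \<epsilon> \<le> cmod (poly p z)" and \<epsilon>: "0 \<le> \<epsilon>"
    and N: "degree (p * q) < N" "degree q < N"
  shows "\<epsilon>\<^sup>2 * (\<Sum>i<N. (cmod (coeff q i))\<^sup>2) \<le> (\<Sum>i<N. (cmod (coeff (p * q) i))\<^sup>2)"
proof -
  let ?w = "\<lambda>k. cis (2 * pi * real k / real N)"
  have "real N * (\<epsilon>\<^sup>2 * (\<Sum>i<N. (cmod (coeff q i))\<^sup>2)) = (\<Sum>k<N. \<epsilon>\<^sup>2 * (cmod (poly q (?w k)))\<^sup>2)"
    using sum_norm_poly_roots_of_unity[OF N(2)] by (simp add: sum_distrib_left[symmetric])
  also have "\<dots> \<le> (\<Sum>k<N. (cmod (poly (p * q) (?w k)))\<^sup>2)"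
    using p \<epsilon> by (intro sum_mono) (auto simp: norm_mult power_mult_distrib intro!: mult_right_mono power_mono)
  also have "\<dots> = real N * (\<Sum>i<N. (cmod (coeff (p * q) i))\<^sup>2)"
    by (rule sum_norm_poly_roots_of_unity[OF N(1)])
  finally show ?thesis using N by (simp add: mult_le_cancel_left)
qed

text \<open>By compactness \<open>p\<close> has no zero in a disc of some radius
  \<open>1 + e\<close>, so the power series of \<open>1 / p\<close> has convergence radius above 1.
  It converges at 1, hence its terms there, the coefficients, tend to 0.\<close>

lemma inverse_poly_coeff_tendsto_0:
  fixes p :: "complex poly"
  assumes p: "\<And>z. cmod z \<le> 1 \<Longrightarrow> poly p z \<noteq> 0"
  shows "(\<lambda>n. fps_nth (inverse (fps_of_poly p)) n) \<longlonglongrightarrow> 0"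
proof -
  have op: "open {z. poly p z \<noteq> 0}"
    by (intro open_Collect_neq continuous_intros)
  obtain e where e: "e > 0" "(\<Union>x\<in>cball 0 1. ball x e) \<subseteq> {z. poly p z \<noteq> 0}"
  proof -
    have "cball 0 1 \<subseteq> {z. poly p z \<noteq> 0}" using p by auto
    then show thesis
      using compact_subset_open_imp_ball_epsilon_subset[OF compact_cball op] that by blast
  qed
  have nz: "poly p z \<noteq> 0" if z: "cmod z < 1 + e" for z
  proof (cases "cmod z \<le> 1")
    case False
    \<comment> \<open>The radial projection of \<open>z\<close> onto the unit circle is
      \<open>cmod z - 1\<close> away, so \<open>z\<close> lies in the zero-free neighbourhood of the
      closed disc.\<close>
    have "dist (z / cmod z) z < e"
    proof -
      have "z / cmod z - z = (1 / cmod z - 1) * z" by (simp add: field_simps)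
      then have "dist (z / cmod z) z = \<bar>1 / cmod z - 1\<bar> * cmod z"
        by (simp add: dist_norm norm_mult) (metis norm_of_real of_real_1 of_real_diff of_real_divide)
      also have "\<dots> = cmod z - 1" 
      proof -
        have z0: "0 < cmod z" using False by linarith
        then have "1 / cmod z - 1 < 0" using False by (simp add: field_simps)
        with z0 show ?thesis by (simp add: abs_of_neg field_simps)
      qed

      finally show ?thesis using z by simp
    qed
    then have "z \<in> ball (z / cmod z) e" by simp
    moreover have "z / cmod z \<in> cball 0 1" by (simp add: norm_divide)
    ultimately show ?thesis using e(2) by blast
  qed (use p in auto)
  have "fps_conv_radius (inverse (fps_of_poly p)) \<ge> min (ereal (1 + e)) (fps_conv_radius (fps_of_poly p))"
    using nz by (intro fps_conv_radius_inverse) auto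
  then have "ereal (1 + e) \<le> fps_conv_radius (inverse (fps_of_poly p))" by simp
  then have "ereal (norm (1::complex)) < fps_conv_radius (inverse (fps_of_poly p))"
    using e(1) by (metis ereal_less(3) less_add_same_cancel1 norm_one order_less_le_trans one_ereal_def ereal_less_eq(3) less_ereal.simps(1))
  then have "summable (\<lambda>n. fps_nth (inverse (fps_of_poly p)) n * 1 ^ n)"
    by (rule summable_fps)
  then show ?thesis by (auto dest: summable_LIMSEQ_zero)
qed

section \<open>Gaussian exponential moments and the sub-Gaussian condition\<close>

lemma nn_integral_normal_density:
  assumes "0 < \<sigma>"
  shows "(\<integral>\<^sup>+x. ennreal (normal_density \<mu> \<sigma> x) \<partial>lborel) = 1"
  using assms by (subst nn_integral_eq_integral) auto

text \<open>Completing the square: the tilt by \<open>exp (a * x)\<close> only moves the mean to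
  \<open>a * \<sigma>\<^sup>2\<close>, up to a constant factor.\<close>

lemma nn_integral_normal_exp_linear:
  assumes "0 < \<sigma>"
  shows "(\<integral>\<^sup>+x. ennreal (normal_density 0 \<sigma> x) * ennreal (exp (a * x)) \<partial>lborel)
           = ennreal (exp (\<sigma>\<^sup>2 / 2 * a\<^sup>2))"
proof -
  have "normal_density 0 \<sigma> x * exp (a * x) = exp (\<sigma>\<^sup>2 / 2 * a\<^sup>2) * normal_density (a * \<sigma>\<^sup>2) \<sigma> x" for x
  proof -
    have "- (x - 0)\<^sup>2 / (2 * \<sigma>\<^sup>2) + a * x = \<sigma>\<^sup>2 / 2 * a\<^sup>2 + - (x - a * \<sigma>\<^sup>2)\<^sup>2 / (2 * \<sigma>\<^sup>2)"
      using assms by (simp add: field_simps power2_eq_square)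
    then have "exp (- (x - 0)\<^sup>2 / (2 * \<sigma>\<^sup>2)) * exp (a * x)
        = exp (\<sigma>\<^sup>2 / 2 * a\<^sup>2) * exp (- (x - a * \<sigma>\<^sup>2)\<^sup>2 / (2 * \<sigma>\<^sup>2))"
      by (metis exp_add)
    then show ?thesis unfolding normal_density_def by (simp add: mult_ac)
  qed
  then have "(\<integral>\<^sup>+x. ennreal (normal_density 0 \<sigma> x) * ennreal (exp (a * x)) \<partial>lborel)
      = (\<integral>\<^sup>+x. ennreal (exp (\<sigma>\<^sup>2 / 2 * a\<^sup>2)) * ennreal (normal_density (a * \<sigma>\<^sup>2) \<sigma> x) \<partial>lborel)"
    by (intro nn_integral_cong) (simp add: ennreal_mult[symmetric])
  then show ?thesis
    using assms by (simp add: nn_integral_cmult nn_integral_normal_density)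
qed

text \<open>The quadratic tilt turns the variance 1 into \<open>1 / (1 - 2 * c)\<close>; the value
  is the ratio of the two normalising constants.\<close>

lemma nn_integral_normal_exp_square:
  assumes c: "2 * c < 1"
  shows "(\<integral>\<^sup>+x. ennreal (std_normal_density x) * ennreal (exp (c * x\<^sup>2)) \<partial>lborel)
           = ennreal (1 / sqrt (1 - 2 * c))"
proof -
  define \<sigma> where "\<sigma> = 1 / sqrt (1 - 2 * c)"
  have \<sigma>: "0 < \<sigma>" using c by (simp add: \<sigma>_def)
  have \<sigma>2: "\<sigma>\<^sup>2 = 1 / (1 - 2 * c)" using c by (simp add: \<sigma>_def power_divide)
  have "std_normal_density x * exp (c * x\<^sup>2) = \<sigma> * normal_density 0 \<sigma> x" for x
  proof -
    have "- x\<^sup>2 / 2 + c * x\<^sup>2 = - (x - 0)\<^sup>2 / (2 * \<sigma>\<^sup>2)"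
      unfolding \<sigma>2 using c by (simp add: field_simps)
    then have *: "exp (- x\<^sup>2 / 2) * exp (c * x\<^sup>2) = exp (- (x - 0)\<^sup>2 / (2 * \<sigma>\<^sup>2))"
      by (metis exp_add)
    have **: "1 / sqrt (2 * pi) = \<sigma> * (1 / sqrt (2 * pi * \<sigma>\<^sup>2))"
      using \<sigma> by (simp add: real_sqrt_mult)
    have "1 / sqrt (2 * pi) * exp (- x\<^sup>2 / 2) * exp (c * x\<^sup>2)
        = 1 / sqrt (2 * pi) * exp (- (x - 0)\<^sup>2 / (2 * \<sigma>\<^sup>2))"
      using * by (simp only: mult.assoc)
    also have "\<dots> = \<sigma> * (1 / sqrt (2 * pi * \<sigma>\<^sup>2)) * exp (- (x - 0)\<^sup>2 / (2 * \<sigma>\<^sup>2))"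
      using ** by (rule arg_cong)
    finally show ?thesis
      unfolding std_normal_density_def unfolding normal_density_def by (simp only: mult.assoc)
  qed
  then have "(\<integral>\<^sup>+x. ennreal (std_normal_density x) * ennreal (exp (c * x\<^sup>2)) \<partial>lborel)
      = (\<integral>\<^sup>+x. ennreal \<sigma> * ennreal (normal_density 0 \<sigma> x) \<partial>lborel)"
    using \<sigma> by (intro nn_integral_cong) (simp add: ennreal_mult[symmetric])
  then show ?thesis
    using \<sigma> by (simp add: nn_integral_cmult nn_integral_normal_density) (simp add: \<sigma>_def)
qed

text \<open>The joint Laplace transform is dominated by that of independent centred normals of
  variance \<open>V\<close>. An upper bound of this kind passes to almost sure limits by Fatou's
  lemma, so the observed process need never be shown to be Gaussian.\<close>

definition sub_gaussian :: "'a measure \<Rightarrow> real \<Rightarrow> ('i \<Rightarrow> 'a \<Rightarrow> real) \<Rightarrow> 'i set \<Rightarrow> bool" where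
  "sub_gaussian M V Y J \<longleftrightarrow>
     (\<forall>g. (\<integral>\<^sup>+\<omega>. ennreal (exp (\<Sum>i\<in>J. g i * Y i \<omega>)) \<partial>M)
            \<le> ennreal (exp (V / 2 * (\<Sum>i\<in>J. (g i)\<^sup>2))))"

lemma sub_gaussian_subset:
  assumes "sub_gaussian M V Y J" "I \<subseteq> J" "finite J"
  shows "sub_gaussian M V Y I"
  unfolding sub_gaussian_def
proof
  fix g
  have "(\<Sum>i\<in>J. (if i \<in> I then g i else 0) * Y i \<omega>) = (\<Sum>i\<in>I. g i * Y i \<omega>)" for \<omega>
    using assms by (intro sum.mono_neutral_cong_right) auto
  moreover have "(\<Sum>i\<in>J. (if i \<in> I then g i else 0)\<^sup>2) = (\<Sum>i\<in>I. (g i)\<^sup>2)"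
    using assms by (intro sum.mono_neutral_cong_right) auto
  ultimately show "(\<integral>\<^sup>+\<omega>. ennreal (exp (\<Sum>i\<in>I. g i * Y i \<omega>)) \<partial>M)
            \<le> ennreal (exp (V / 2 * (\<Sum>i\<in>I. (g i)\<^sup>2)))"
    using assms(1)[unfolded sub_gaussian_def, rule_format, of "\<lambda>i. if i \<in> I then g i else 0"] by simp
qed

lemma sub_gaussian_reindex:
  assumes "sub_gaussian M V Y (f ` I)" "inj_on f I"
  shows "sub_gaussian M V (\<lambda>i. Y (f i)) I"
  unfolding sub_gaussian_def
proof
  fix g
  have *: "inv_into I f (f i) = i" if "i \<in> I" for i using assms(2) that by simp
  have "(\<Sum>i\<in>f ` I. g (inv_into I f i) * Y i \<omega>) = (\<Sum>i\<in>I. g i * Y (f i) \<omega>)" for \<omega>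
    using assms(2) by (subst sum.reindex) (auto intro!: sum.cong simp: *)
  moreover have "(\<Sum>i\<in>f ` I. (g (inv_into I f i))\<^sup>2) = (\<Sum>i\<in>I. (g i)\<^sup>2)"
    using assms(2) by (subst sum.reindex) (auto intro!: sum.cong simp: *)
  ultimately show "(\<integral>\<^sup>+\<omega>. ennreal (exp (\<Sum>i\<in>I. g i * Y (f i) \<omega>)) \<partial>M)
            \<le> ennreal (exp (V / 2 * (\<Sum>i\<in>I. (g i)\<^sup>2)))"
    using assms(1)[unfolded sub_gaussian_def, rule_format, of "\<lambda>i. g (inv_into I f i)"] by simp
qed

lemma (in prob_space) sub_gaussian_indep_normal:
  assumes I: "finite I" and indep: "indep_vars (\<lambda>_. borel) U I" and \<sigma>: "0 < \<sigma>"
    and U: "\<And>i. i \<in> I \<Longrightarrow> distributed M lborel (U i) (normal_density 0 \<sigma>)"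
  shows "sub_gaussian M (\<sigma>\<^sup>2) U I"
  unfolding sub_gaussian_def
proof
  fix g :: "_ \<Rightarrow> real"
  have one: "(\<integral>\<^sup>+\<omega>. ennreal (exp (g i * U i \<omega>)) \<partial>M) = ennreal (exp (\<sigma>\<^sup>2 / 2 * (g i)\<^sup>2))" if "i \<in> I" for i
    using distributed_nn_integral[OF U[OF that], of "\<lambda>x. ennreal (exp (g i * x))"]
      nn_integral_normal_exp_linear[OF \<sigma>, of "g i"] by simp
  have indep': "indep_vars (\<lambda>_. borel) (\<lambda>i \<omega>. ennreal (exp (g i * U i \<omega>))) I"
    using indep by (rule indep_vars_compose2) auto
  have "(\<integral>\<^sup>+\<omega>. ennreal (exp (\<Sum>i\<in>I. g i * U i \<omega>)) \<partial>M)
      = (\<integral>\<^sup>+\<omega>. (\<Prod>i\<in>I. ennreal (exp (g i * U i \<omega>))) \<partial>M)"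
    by (intro nn_integral_cong) (simp add: exp_sum[OF I] prod_ennreal)
  also have "\<dots> = (\<Prod>i\<in>I. \<integral>\<^sup>+\<omega>. ennreal (exp (g i * U i \<omega>)) \<partial>M)"
    by (rule indep_vars_nn_integral[OF I indep']) simp
  also have "\<dots> = ennreal (exp (\<sigma>\<^sup>2 / 2 * (\<Sum>i\<in>I. (g i)\<^sup>2)))"
    by (simp add: one prod_ennreal exp_sum[OF I] sum_distrib_left)
  finally show "(\<integral>\<^sup>+\<omega>. ennreal (exp (\<Sum>i\<in>I. g i * U i \<omega>)) \<partial>M)
      \<le> ennreal (exp (\<sigma>\<^sup>2 / 2 * (\<Sum>i\<in>I. (g i)\<^sup>2)))" by simp
qed

text \<open>Linearisation by an independent standard normal vector \<open>G\<close>: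
  \<open>exp (s \<bar>Y\<bar>\<^sup>2) = E\<^sub>G exp (sqrt (2 s) \<langle>G, Y\<rangle>)\<close>.\<close>

lemma (in prob_space) sub_gaussian_exp_sum_squares:
  assumes J: "finite J" and Y: "\<And>i. i \<in> J \<Longrightarrow> Y i \<in> borel_measurable M"
    and sg: "sub_gaussian M V Y J" and s: "0 \<le> s" "2 * (s * V) < 1"
  shows "(\<integral>\<^sup>+\<omega>. ennreal (exp (s * (\<Sum>i\<in>J. (Y i \<omega>)\<^sup>2))) \<partial>M)
           \<le> ennreal ((1 / sqrt (1 - 2 * (s * V))) ^ card J)"
proof -
  note [measurable] = Y
  define N :: "real measure" where "N = density lborel (\<lambda>x. ennreal (std_normal_density x))"
  define Q where "Q = (\<Pi>\<^sub>M i\<in>J. N)"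
  interpret N: prob_space N unfolding N_def by (rule prob_space_normal_density) simp
  interpret PN: finite_product_prob_space "\<lambda>_. N" J by standard (rule J)
  have sets_N[measurable_cong]: "sets N = sets borel" by (simp add: N_def)
  have sets_Q[measurable_cong]: "sets Q = sets (\<Pi>\<^sub>M i\<in>J. borel)"
    unfolding Q_def by (intro sets_PiM_cong) (auto simp: sets_N)
  interpret Q: prob_space Q unfolding Q_def by (rule PN.prob_space_axioms)
  interpret MP: pair_sigma_finite M Q ..
  have N_int: "(\<integral>\<^sup>+x. ennreal (f x) \<partial>N) = (\<integral>\<^sup>+x. ennreal (std_normal_density x) * ennreal (f x) \<partial>lborel)"
    if "f \<in> borel_measurable borel" for f
    unfolding N_def using that by (subst nn_integral_density) auto
  have lin: "ennreal (exp (s * (\<Sum>i\<in>J. (Y i \<omega>)\<^sup>2)))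
      = (\<integral>\<^sup>+\<gamma>. ennreal (exp (\<Sum>i\<in>J. (sqrt (2 * s) * \<gamma> i) * Y i \<omega>)) \<partial>Q)" for \<omega>
  proof -
    have "(\<integral>\<^sup>+\<gamma>. ennreal (exp (\<Sum>i\<in>J. (sqrt (2 * s) * \<gamma> i) * Y i \<omega>)) \<partial>Q)
        = (\<integral>\<^sup>+\<gamma>. (\<Prod>i\<in>J. ennreal (exp ((sqrt (2 * s) * Y i \<omega>) * \<gamma> i))) \<partial>Q)"
      by (intro nn_integral_cong) (simp add: exp_sum[OF J] prod_ennreal mult_ac)
    also have "\<dots> = (\<Prod>i\<in>J. \<integral>\<^sup>+x. ennreal (exp ((sqrt (2 * s) * Y i \<omega>) * x)) \<partial>N)"
      unfolding Q_def
      by (rule PN.product_nn_integral_prod[OF J, of "\<lambda>i x. ennreal (exp ((sqrt (2 * s) * Y i \<omega>) * x))"]) measurable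
    also have "\<dots> = (\<Prod>i\<in>J. ennreal (exp (s * (Y i \<omega>)\<^sup>2)))"
      using s by (intro prod.cong refl)
        (simp add: N_int nn_integral_normal_exp_linear power_mult_distrib)
    also have "\<dots> = ennreal (exp (s * (\<Sum>i\<in>J. (Y i \<omega>)\<^sup>2)))"
      by (simp add: exp_sum[OF J] prod_ennreal sum_distrib_left)
    finally show ?thesis by simp
  qed
  have "(\<integral>\<^sup>+\<omega>. ennreal (exp (s * (\<Sum>i\<in>J. (Y i \<omega>)\<^sup>2))) \<partial>M)
      = (\<integral>\<^sup>+\<omega>. \<integral>\<^sup>+\<gamma>. ennreal (exp (\<Sum>i\<in>J. (sqrt (2 * s) * \<gamma> i) * Y i \<omega>)) \<partial>Q \<partial>M)"
    by (simp only: lin)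
  \<comment> \<open>By Tonelli the Gaussian vector moves outside; for each fixed
    \<open>\<gamma>\<close> the hypothesis applies with coefficients
    \<open>sqrt (2 * s) * \<gamma> i\<close>. What remains is a product of one-dimensional quadratic
    moments, finite because \<open>2 * (s * V) < 1\<close>.\<close>
  also have "\<dots> = (\<integral>\<^sup>+\<gamma>. \<integral>\<^sup>+\<omega>. ennreal (exp (\<Sum>i\<in>J. (sqrt (2 * s) * \<gamma> i) * Y i \<omega>)) \<partial>M \<partial>Q)"
    by (intro MP.Fubini'[symmetric]) measurable
  also have "\<dots> \<le> (\<integral>\<^sup>+\<gamma>. ennreal (exp (V / 2 * (\<Sum>i\<in>J. (sqrt (2 * s) * \<gamma> i)\<^sup>2))) \<partial>Q)"
    using sg unfolding sub_gaussian_def by (intro nn_integral_mono) simp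
  also have "\<dots> = (\<integral>\<^sup>+\<gamma>. (\<Prod>i\<in>J. ennreal (exp ((s * V) * (\<gamma> i)\<^sup>2))) \<partial>Q)"
    using s by (intro nn_integral_cong)
      (simp add: exp_sum[OF J, symmetric] prod_ennreal power_mult_distrib sum_distrib_left mult_ac)
  also have "\<dots> = (\<Prod>i\<in>J. \<integral>\<^sup>+x. ennreal (exp ((s * V) * x\<^sup>2)) \<partial>N)"
    unfolding Q_def
    by (rule PN.product_nn_integral_prod[OF J, of "\<lambda>i x. ennreal (exp ((s * V) * x\<^sup>2))"]) measurable
  also have "\<dots> = ennreal ((1 / sqrt (1 - 2 * (s * V))) ^ card J)"
    using s by (simp add: N_int nn_integral_normal_exp_square ennreal_power)
  finally show ?thesis .
qed

section \<open>An upper bound on the concentration constant\<close>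

text \<open>For one standard normal \<open>q\<close> the tail of \<open>q^2\<close> at
  \<open>4\<tau>\<close> decays like \<open>exp (- 2\<tau>)\<close> up to lower-order factors, so
  \<open>c\<close> cannot much exceed 2. Taking \<open>\<tau> = 110\<close> makes those factors
  small enough for the bound 9/4.\<close>

lemma gaussian_concentration_constant_le:
  assumes c: "gaussian_concentration_constant c"
  shows "c \<le> 9 / 4"
proof -
  define N :: "real measure" where "N = density lborel (\<lambda>x. ennreal (std_normal_density x))"
  define \<nu> where "\<nu> = (\<Pi>\<^sub>M i\<in>{1..1::nat}. N)"
  define S :: "nat \<Rightarrow> nat \<Rightarrow> real" where "S = (\<lambda>_ _. 1)"
  interpret N: prob_space N unfolding N_def by (rule prob_space_normal_density) simp
  interpret product_prob_space "\<lambda>_. N" "{1..1::nat}" by standard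
  interpret finite_product_prob_space "\<lambda>_. N" "{1..1::nat}" by standard simp
  have sets_N[measurable_cong]: "sets N = sets borel" by (simp add: N_def)
  have sets_\<nu>[measurable_cong]: "sets \<nu> = sets (\<Pi>\<^sub>M i\<in>{1..1}. borel)"
    unfolding \<nu>_def by (intro sets_PiM_cong) (auto simp: sets_N)
  interpret \<nu>: prob_space \<nu> unfolding \<nu>_def by (rule prob_space_axioms)
  have distr: "distr \<nu> N (\<lambda>q. q 1) = N"
    unfolding \<nu>_def by (rule PiM_component) simp
  have q1: "distributed \<nu> lborel (\<lambda>q. q 1) (\<lambda>x. ennreal (std_normal_density x))"
    unfolding distributed_def
  proof (intro conjI)
    have "distr \<nu> lborel (\<lambda>q. q 1) = distr \<nu> N (\<lambda>q. q 1)"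
      by (intro distr_cong) (auto simp: sets_N)
    then show "distr \<nu> lborel (\<lambda>q. q 1) = density lborel (\<lambda>x. ennreal (std_normal_density x))"
      using distr by (simp add: N_def)
  next
    show "(\<lambda>q. q 1) \<in> measurable \<nu> lborel" by measurable
    show "(\<lambda>x. ennreal (std_normal_density x)) \<in> borel_measurable lborel" by measurable
  qed
  have gauss: "centred_gaussian 1 S \<nu>"
    unfolding centred_gaussian_def
  proof (intro conjI allI impI)
    show "prob_space \<nu>" by (rule \<nu>.prob_space_axioms)
    show "sets \<nu> = sets (\<Pi>\<^sub>M i\<in>{1..1}. borel)" by (rule sets_\<nu>)
    fix a :: "nat \<Rightarrow> real" assume "\<exists>i\<in>{1..1}. a i \<noteq> 0"
    then show "distributed \<nu> lborel (\<lambda>q. \<Sum>i=1..1. a i * q i)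
          (normal_density 0 (sqrt (\<Sum>i=1..1. \<Sum>j=1..1. a i * S i j * a j)))"
      using \<nu>.normal_density_affine[OF q1, of "a 1" 0] by (simp add: S_def)
  qed
  have pos_def: "sym_pos_def 1 S"
    by (auto simp: sym_pos_def_def S_def zero_less_mult_iff linorder_neq_iff)
  have conc: "measure \<nu> {q \<in> space \<nu>.
            1 / real 1 * \<bar>(\<Sum>i=1..1. q i * q i) - (\<Sum>i=1..1. S i i)\<bar> \<ge> 4 * 110 * op_norm 1 S}
          \<le> 2 * exp (- c * real 1 * min (110\<^sup>2) 110)"
  proof -
    have "\<forall>d\<ge>1. \<forall>S \<nu>. \<forall>\<tau>>0. sym_pos_def d S \<longrightarrow> centred_gaussian d S \<nu> \<longrightarrow>
        measure \<nu> {q \<in> space \<nu>.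
            1 / real d * \<bar>(\<Sum>i=1..d. q i * q i) - (\<Sum>i=1..d. S i i)\<bar> \<ge> 4 * \<tau> * op_norm d S}
          \<le> 2 * exp (- c * real d * min (\<tau>\<^sup>2) \<tau>)"
      using c unfolding gaussian_concentration_constant_def by (rule conjunct2)
    from this[rule_format, of 1 110 S \<nu>] show ?thesis
      using pos_def gauss by simp
  qed
  have op: "op_norm 1 S \<le> 1"
    unfolding op_norm_def
  proof (rule cSup_least)
    show "{L2_set (\<lambda>i. \<Sum>j=1..1. S i j * a j) {1..1} | a. L2_set a {1..1} \<le> 1} \<noteq> {}"
      by (auto intro!: exI[of _ "\<lambda>_. 0"])
  qed (auto simp: S_def)
  \<comment> \<open>On this interval of length 1 the density is at least
    \<open>exp (- 2) * exp (- 242)\<close>: the first factor bounds \<open>1 / sqrt (2 * pi)\<close>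
    from below, and \<open>242 = 22 * 22 / 2\<close>.\<close>
  have "exp (- 244) \<le> measure \<nu> {q \<in> space \<nu>. q 1 \<in> {21..22}}"
  proof -
    have "ennreal (exp (- 244)) = (\<integral>\<^sup>+x\<in>{21..22::real}. ennreal (exp (- 244)) \<partial>lborel)"
      by (simp add: nn_integral_cmult_indicator)
    also have "\<dots> \<le> (\<integral>\<^sup>+x\<in>{21..22}. ennreal (std_normal_density x) \<partial>lborel)"
    proof (intro nn_integral_mono)
      fix x :: real
      show "ennreal (exp (- 244)) * indicator {21..22} x \<le> ennreal (std_normal_density x) * indicator {21..22} x"
      proof (cases "x \<in> {21..22}")
        case True
        have "sqrt (2 * pi) \<le> sqrt (4 * 4)"
          using pi_less_4 by (intro real_sqrt_le_mono) auto
        then have pi: "sqrt (2 * pi) \<le> 4" by simp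
        have "(2::real) * 2 \<le> exp 1 * exp 1"
          using exp_ge_add_one_self[of "1::real"] by (intro mult_mono) auto
        then have "sqrt (2 * pi) \<le> exp 2"
          using pi by (simp add: exp_add[symmetric])
        then have "exp (- 2) \<le> 1 / sqrt (2 * pi)"
          by (simp add: exp_minus field_simps)
        moreover have "x\<^sup>2 \<le> 22\<^sup>2" using True by (intro power_mono) auto
        then have "exp (- 242) \<le> exp (- x\<^sup>2 / 2)" by simp
        ultimately have "exp (- 2) * exp (- 242) \<le> std_normal_density x"
          unfolding std_normal_density_def by (intro mult_mono) auto
        then show ?thesis using True by (simp add: exp_add[symmetric] ennreal_leI)
      qed auto
    qed
    also have "\<dots> = emeasure \<nu> {q \<in> space \<nu>. q 1 \<in> {21..22}}"
      using distributed_emeasure[OF q1, of "{21..22}"] by (simp add: vimage_def Int_def conj_commute)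
    finally show ?thesis by (simp add: \<nu>.emeasure_eq_measure)
  qed
  also have "\<dots> \<le> measure \<nu> {q \<in> space \<nu>.
            1 / real 1 * \<bar>(\<Sum>i=1..1. q i * q i) - (\<Sum>i=1..1. S i i)\<bar> \<ge> 4 * 110 * op_norm 1 S}"
  proof (rule \<nu>.finite_measure_mono)
    show "{q \<in> space \<nu>. q 1 \<in> {21..22}} \<subseteq> {q \<in> space \<nu>.
            1 / real 1 * \<bar>(\<Sum>i=1..1. q i * q i) - (\<Sum>i=1..1. S i i)\<bar> \<ge> 4 * 110 * op_norm 1 S}"
    proof safe
      fix q assume "q (1::nat) \<in> {21..22::real}"
      \<comment> \<open>The numbers match because \<open>21 * 21 - 1 = 4 * 110\<close>, and the
        operator norm is at most 1.\<close>
      then have "21 * 21 \<le> q 1 * q 1" by (intro mult_mono) auto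
      then show "4 * 110 * op_norm 1 S \<le> 1 / real 1 * \<bar>(\<Sum>i=1..1. q i * q i) - (\<Sum>i=1..1. S i i)\<bar>"
        using op by (simp add: S_def)
    qed
    show "{q \<in> space \<nu>. 1 / real 1 * \<bar>(\<Sum>i=1..1. q i * q i) - (\<Sum>i=1..1. S i i)\<bar> \<ge> 4 * 110 * op_norm 1 S} \<in> sets \<nu>"
      by measurable
  qed
  also have "\<dots> \<le> 2 * exp (- c * 110)" using conc by simp
  also have "\<dots> \<le> exp 1 * exp (- c * 110)"
    using exp_ge_add_one_self[of "1::real"] by (intro mult_right_mono) auto
  \<comment> \<open>This gives \<open>c \<le> 245 / 110\<close>, which is below 9/4.\<close>
  finally have "- 244 \<le> 1 + - c * 110"
    by (simp only: exp_add[symmetric] exp_le_cancel_iff)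
  then show ?thesis by simp
qed

section \<open>The autoregressive filter and its inverse\<close>

text \<open>The filter that recovers an innovation from the observations: \<open>u t\<close> is the
  sum of \<open>ar_coeff L b j * x (t - j)\<close>. Extension by zero beyond \<open>L\<close> lets
  convolutions run over all indices.\<close>

definition ar_coeff :: "nat \<Rightarrow> (nat \<Rightarrow> real) \<Rightarrow> nat \<Rightarrow> real" where
  "ar_coeff L b i = (if i = 0 then 1 else if i \<le> L then - b i else 0)"

lemma ar_coeff_eq_0 [simp]: "L < i \<Longrightarrow> ar_coeff L b i = 0"
  by (simp add: ar_coeff_def)

definition ar_complex_poly :: "nat \<Rightarrow> (nat \<Rightarrow> real) \<Rightarrow> complex poly" where
  "ar_complex_poly L b = (\<Sum>i\<le>L. monom (of_real (ar_coeff L b i)) i)"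

lemma coeff_ar_complex_poly: "coeff (ar_complex_poly L b) i = of_real (ar_coeff L b i)"
  by (simp add: ar_complex_poly_def coeff_sum)

lemma poly_ar_complex_poly: "poly (ar_complex_poly L b) z = ar_poly L b z"
proof -
  have "poly (ar_complex_poly L b) z = (\<Sum>i\<le>L. of_real (ar_coeff L b i) * z ^ i)"
    by (simp add: ar_complex_poly_def poly_sum poly_monom)
  also have "{..L} = insert 0 {1..L}" by auto
  also have "(\<Sum>i\<in>insert 0 {1..L}. of_real (ar_coeff L b i) * z ^ i) = ar_poly L b z"
  proof -
    have "(\<Sum>i=1..L. of_real (ar_coeff L b i) * z ^ i) = (\<Sum>i=1..L. - (of_real (b i) * z ^ i))"
      by (intro sum.cong) (auto simp: ar_coeff_def)
    then show ?thesis by (simp add: ar_poly_def ar_coeff_def sum_negf)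
  qed
  finally show ?thesis .
qed

lemma degree_ar_complex_poly: "degree (ar_complex_poly L b) \<le> L"
  by (rule degree_le) (simp add: coeff_ar_complex_poly)

lemma eps_stable_norm_ge:
  assumes "eps_stable \<epsilon> L b" "cmod z = 1"
  shows "\<epsilon> \<le> cmod (ar_poly L b z)"
proof -
  have "(INF z\<in>sphere 0 1. cmod (ar_poly L b z)) \<le> cmod (ar_poly L b z)"
    using assms(2) by (intro cINF_lower bdd_belowI2[of _ 0]) auto
  then show ?thesis using assms(1) by (simp add: eps_stable_def)
qed

lemma sum_ar_coeff:
  "(\<Sum>j\<le>L. ar_coeff L b j * y j) = y 0 - (\<Sum>l=1..L. b l * y l)"
proof -
  have "{..L} = insert 0 {1..L}" by auto
  moreover have "(\<Sum>l=1..L. ar_coeff L b l * y l) = (\<Sum>l=1..L. - (b l * y l))"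
    by (intro sum.cong) (auto simp: ar_coeff_def)
  ultimately show ?thesis by (simp add: ar_coeff_def sum_negf)
qed

text \<open>As a formal power series, \<open>h\<close> is the truncation of \<open>g\<close> at
  \<open>K\<close> divided by the autoregressive polynomial. By stability the coefficients
  \<open>\<psi>\<close> of the inverse tend to 0, and eventually \<open>h n\<close> is a combination
  of \<open>K + 1\<close> shifts of \<open>\<psi>\<close>.\<close>

lemma ar_solution_exists:
  fixes g :: "nat \<Rightarrow> real"
  assumes b: "eps_stable \<epsilon> L b"
  shows "\<exists>h. h \<longlonglongrightarrow> 0 \<and> (\<forall>n. (\<Sum>i\<le>n. ar_coeff L b i * h (n - i)) = (if n \<le> K then g n else 0))"
proof -
  define p where "p = fps_of_poly (ar_complex_poly L b)"
  define \<psi> where "\<psi> n = Re (fps_nth (inverse p) n)" for n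
  have "(\<lambda>n. fps_nth (inverse p) n) \<longlonglongrightarrow> 0"
    unfolding p_def using b
    by (intro inverse_poly_coeff_tendsto_0) (auto simp: poly_ar_complex_poly eps_stable_def)
  then have \<psi>: "\<psi> \<longlonglongrightarrow> 0" unfolding \<psi>_def using tendsto_Re by fastforce
  have p0: "fps_nth p 0 = 1" by (simp add: p_def coeff_ar_complex_poly ar_coeff_def)
  have "p * inverse p = 1" using p0 by (intro inverse_mult_eq_1') simp
  \<comment> \<open>The filter coefficients are real, so taking real parts preserves the convolution
    identity.\<close>
  then have "Re (fps_nth (p * inverse p) n) = (if n = 0 then 1 else 0)" for n by simp
  then have conv: "(\<Sum>i=0..n. ar_coeff L b i * \<psi> (n - i)) = (if n = 0 then 1 else 0)" for n
    by (simp add: fps_mult_nth p_def coeff_ar_complex_poly \<psi>_def)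
  define \<Phi> \<Psi> G where "\<Phi> = Abs_fps (ar_coeff L b)" and "\<Psi> = Abs_fps \<psi>"
    and "G = Abs_fps (\<lambda>n. if n \<le> K then g n else 0)"
  have "\<Phi> * \<Psi> = 1"
    by (rule fps_ext) (simp add: \<Phi>_def \<Psi>_def fps_mult_nth conv)
  then have H: "\<Phi> * (G * \<Psi>) = G" by (metis mult.left_commute mult.right_neutral)
  define h where "h n = fps_nth (G * \<Psi>) n" for n
  have "(\<Sum>i\<le>n. ar_coeff L b i * h (n - i)) = (if n \<le> K then g n else 0)" for n
  proof -
    have "(\<Sum>i\<le>n. ar_coeff L b i * h (n - i)) = fps_nth (\<Phi> * (G * \<Psi>)) n"
      unfolding fps_mult_nth[of \<Phi> "G * \<Psi>"] h_def by (simp add: \<Phi>_def atLeast0AtMost)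
    then show ?thesis unfolding H by (simp add: G_def)
  qed
  moreover have "h \<longlonglongrightarrow> 0"
  proof -
    have "(\<lambda>n. \<Sum>k\<le>K. g k * \<psi> (n - k)) \<longlonglongrightarrow> (\<Sum>k\<le>K. g k * 0)"
      by (intro tendsto_sum tendsto_mult tendsto_const filterlim_compose[OF \<psi>] filterlim_minus_const_nat_at_top)
    moreover have "eventually (\<lambda>n. (\<Sum>k\<le>K. g k * \<psi> (n - k)) = h n) sequentially"
      using eventually_ge_at_top[of K]
    proof eventually_elim
      case (elim n)
      have "h n = (\<Sum>k\<le>n. (if k \<le> K then g k else 0) * \<psi> (n - k))"
        by (simp add: h_def fps_mult_nth G_def \<Psi>_def atLeast0AtMost)
      also have "\<dots> = (\<Sum>k\<le>K. g k * \<psi> (n - k))"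
        using elim by (intro sum.mono_neutral_cong_right) auto
      finally show ?case by simp
    qed
    ultimately show ?thesis by (auto dest: Lim_transform_eventually)
  qed
  ultimately show ?thesis by blast
qed

text \<open>Collecting terms by \<open>r = k + j\<close> moves the filter \<open>g\<close> from the
  sequence \<open>y\<close> onto the kernel \<open>f\<close>, as summation by parts would.\<close>

lemma sum_product_shift:
  fixes f g y :: "nat \<Rightarrow> real"
  assumes f: "\<And>k. n < k \<Longrightarrow> f k = 0" and g: "\<And>j. L < j \<Longrightarrow> g j = 0"
  shows "(\<Sum>k\<le>n. f k * (\<Sum>j\<le>L. g j * y (k + j)))
           = (\<Sum>r\<le>n + L. (\<Sum>i\<le>r. g i * f (r - i)) * y r)"
proof -
  \<comment> \<open>The triangle of pairs \<open>(r, i)\<close> is larger than the image of the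
    rectangle; \<open>Z\<close> holds the surplus pairs, whose terms vanish by the support
    assumptions.\<close>
  define Z where "Z = {(r, i) \<in> (SIGMA r:{..n + L}. {..r}). L < i \<or> n < r - i}"
  have Z: "finite Z"
    unfolding Z_def by (rule finite_subset[of _ "SIGMA r:{..n + L}. {..r}"]) auto
  have "(\<Sum>k\<le>n. f k * (\<Sum>j\<le>L. g j * y (k + j)))
      = (\<Sum>(k, j)\<in>{..n} \<times> {..L}. f k * (g j * y (k + j)))"
    by (simp add: sum_distrib_left sum.cartesian_product)
  also have "\<dots> = (\<Sum>(r, i)\<in>(SIGMA r:{..n + L}. {..r}). g i * f (r - i) * y r)"
    by (rule sum.reindex_bij_witness_not_neutral
        [where S' = "{}" and T' = Z
          and i = "\<lambda>(r, i). (r - i, i)" and j = "\<lambda>(k, j). (k + j, j)", OF finite.emptyI Z])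
       (auto simp: f g not_less Z_def)
  also have "\<dots> = (\<Sum>r\<le>n + L. (\<Sum>i\<le>r. g i * f (r - i)) * y r)"
    by (subst sum.Sigma[symmetric]) (auto simp: sum_distrib_right)
  finally show ?thesis .
qed

text \<open>The convolution lists the coefficients of the product of the filter polynomial with the
  polynomial of \<open>f\<close>. Stability bounds the first factor below by
  \<open>\<epsilon>\<close> on the unit circle, so the coefficient form of Parseval applies.\<close>

lemma ar_filter_energy:
  fixes f :: "nat \<Rightarrow> real"
  assumes b: "eps_stable \<epsilon> L b" and \<epsilon>: "0 < \<epsilon>" and f: "\<And>k. n < k \<Longrightarrow> f k = 0"
  shows "\<epsilon>\<^sup>2 * (\<Sum>k\<le>n. (f k)\<^sup>2) \<le> (\<Sum>r\<le>n + L. (\<Sum>i\<le>r. ar_coeff L b i * f (r - i))\<^sup>2)"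
proof -
  define p where "p = ar_complex_poly L b"
  define q where "q = (\<Sum>k\<le>n. monom (complex_of_real (f k)) k)"
  have cq: "coeff q k = of_real (f k)" for k
    using f by (auto simp: q_def coeff_sum)
  have dq: "degree q \<le> n" by (rule degree_le) (simp add: cq f)
  have dpq: "degree (p * q) \<le> n + L"
    using degree_mult_le[of p q] degree_ar_complex_poly[of L b] dq by (simp add: p_def)
  have cpq: "coeff (p * q) r = of_real (\<Sum>i\<le>r. ar_coeff L b i * f (r - i))" for r
    by (simp add: coeff_mult p_def coeff_ar_complex_poly cq)
  have "\<epsilon>\<^sup>2 * (\<Sum>i<Suc (n + L). (cmod (coeff q i))\<^sup>2) \<le> (\<Sum>i<Suc (n + L). (cmod (coeff (p * q) i))\<^sup>2)"
    using b \<epsilon> dq dpq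
    by (intro sum_norm_coeff_mult_ge) (auto simp: p_def poly_ar_complex_poly eps_stable_norm_ge)
  moreover have "(\<Sum>i<Suc (n + L). (cmod (coeff q i))\<^sup>2) = (\<Sum>k\<le>n. (f k)\<^sup>2)"
    unfolding cq by (rule sum.mono_neutral_cong_right) (auto simp: f)
  moreover have "(\<Sum>i<Suc (n + L). (cmod (coeff (p * q) i))\<^sup>2)
      = (\<Sum>r\<le>n + L. (\<Sum>i\<le>r. ar_coeff L b i * f (r - i))\<^sup>2)"
    unfolding cpq by (simp only: norm_of_real power2_abs lessThan_Suc_atMost)
  ultimately show ?thesis by simp
qed

section \<open>Sub-Gaussianity of stationary autoregressions\<close>

lemma stationary_process_distr:
  assumes "stationary_process P x"
  shows "distr P borel (x t) = distr P borel (x 0)"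
proof -
  let ?F = "\<Pi>\<^sub>M t\<in>UNIV. borel"
  have [measurable]: "x t \<in> borel_measurable P" for t
    using assms by (simp add: stationary_process_def)
  have "distr P ?F (\<lambda>\<omega> s. x (s + t) \<omega>) = distr P ?F (\<lambda>\<omega> s. x s \<omega>)"
    using assms by (simp add: stationary_process_def)
  then have "distr (distr P ?F (\<lambda>\<omega> s. x (s + t) \<omega>)) borel (\<lambda>f. f 0)
      = distr (distr P ?F (\<lambda>\<omega> s. x s \<omega>)) borel (\<lambda>f. f 0)" by simp
  moreover have [measurable]: "(\<lambda>\<omega> s. x (s + h) \<omega>) \<in> measurable P ?F" for h
    by (rule measurable_PiM_single') auto
  have "distr (distr P ?F (\<lambda>\<omega> s. x (s + h) \<omega>)) borel (\<lambda>f. f 0) = distr P borel (x h)" for h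
    by (subst distr_distr) (auto simp: o_def)
  from this[of t] this[of 0] 
  have "distr (distr P ?F (\<lambda>\<omega> s. x (s + t) \<omega>)) borel (\<lambda>f. f 0) = distr P borel (x t)"
    "distr (distr P ?F (\<lambda>\<omega> s. x s \<omega>)) borel (\<lambda>f. f 0) = distr P borel (x 0)" by simp_all
  ultimately show ?thesis by simp
qed

text \<open>Stationarity alone provides no moments, so smallness is measured by the expectation of
  \<open>min 1 \<bar>R n\<bar>\<close>. Each term has the law of \<open>d i n * x 0\<close> whatever
  its time index, so dominated convergence applies; convergence in mean then yields an almost surely
  convergent subsequence.\<close>

lemma (in prob_space) stationary_remainder_subseq:
  assumes x: "stationary_process M x" and I: "finite I"
    and d: "\<And>i. i \<in> I \<Longrightarrow> (\<lambda>n. d i n) \<longlonglongrightarrow> (0 :: real)"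
  shows "\<exists>r :: nat \<Rightarrow> nat. strict_mono r \<and>
     (AE \<omega> in M. (\<lambda>n. \<Sum>i\<in>I. d i (r n) * x (s i (r n)) \<omega>) \<longlonglongrightarrow> 0)"
proof -
  have x_meas[measurable]: "x t \<in> borel_measurable M" for t
    using x by (simp add: stationary_process_def)
  define R where "R n \<omega> = (\<Sum>i\<in>I. d i n * x (s i n) \<omega>)" for n \<omega>
  have [measurable]: "R n \<in> borel_measurable M" for n unfolding R_def by measurable
  have int: "integrable M (\<lambda>\<omega>. min 1 \<bar>f \<omega>\<bar>)" if [measurable]: "f \<in> borel_measurable M" for f :: "'a \<Rightarrow> real"
    by (rule integrable_const_bound[of _ 1]) auto
  have same: "expectation (\<lambda>\<omega>. min 1 \<bar>c * x t \<omega>\<bar>) = expectation (\<lambda>\<omega>. min 1 \<bar>c * x 0 \<omega>\<bar>)" for c t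
  proof -
    have "expectation (\<lambda>\<omega>. min 1 \<bar>c * x t \<omega>\<bar>) = (\<integral>y. min 1 \<bar>c * y\<bar> \<partial>distr M borel (x t))"
      by (subst integral_distr) auto
    also have "\<dots> = (\<integral>y. min 1 \<bar>c * y\<bar> \<partial>distr M borel (x 0))"
      by (simp only: stationary_process_distr[OF x, of t])
    also have "\<dots> = expectation (\<lambda>\<omega>. min 1 \<bar>c * x 0 \<omega>\<bar>)"
      by (subst integral_distr) auto
    finally show ?thesis .
  qed
  have "(\<lambda>n. expectation (\<lambda>\<omega>. min 1 \<bar>d i n * x 0 \<omega>\<bar>)) \<longlonglongrightarrow> expectation (\<lambda>\<omega>. 0)" if "i \<in> I" for i
  proof (rule integral_dominated_convergence[where w = "\<lambda>_. 1"])
    have "(\<lambda>n. min 1 \<bar>d i n * x 0 \<omega>\<bar>) \<longlonglongrightarrow> min 1 \<bar>0 * x 0 \<omega>\<bar>" for \<omega>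
      by (intro tendsto_intros d that)
    then show "AE \<omega> in M. (\<lambda>n. min 1 \<bar>d i n * x 0 \<omega>\<bar>) \<longlonglongrightarrow> 0" by simp
  qed auto
  then have "(\<lambda>n. \<Sum>i\<in>I. expectation (\<lambda>\<omega>. min 1 \<bar>d i n * x 0 \<omega>\<bar>)) \<longlonglongrightarrow> (\<Sum>i\<in>I. 0)"
    by (intro tendsto_sum) simp
  then have lim: "(\<lambda>n. \<Sum>i\<in>I. expectation (\<lambda>\<omega>. min 1 \<bar>d i n * x 0 \<omega>\<bar>)) \<longlonglongrightarrow> 0" by simp
  have min_sum: "min 1 \<bar>\<Sum>i\<in>A. f i\<bar> \<le> (\<Sum>i\<in>A. min 1 \<bar>f i\<bar>)" if "finite A" for A and f :: "'b \<Rightarrow> real"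
    using that
  proof (induction A rule: finite_induct)
    case (insert i A)
    have "0 \<le> (\<Sum>i\<in>A. min 1 \<bar>f i\<bar>)" by (intro sum_nonneg) auto
    then show ?case using insert by (simp add: min_def abs_if split: if_splits)
  qed simp
  have le: "expectation (\<lambda>\<omega>. norm (min 1 \<bar>R n \<omega>\<bar>)) \<le> (\<Sum>i\<in>I. expectation (\<lambda>\<omega>. min 1 \<bar>d i n * x 0 \<omega>\<bar>))" for n
  proof -
    have "expectation (\<lambda>\<omega>. norm (min 1 \<bar>R n \<omega>\<bar>)) \<le> expectation (\<lambda>\<omega>. \<Sum>i\<in>I. min 1 \<bar>d i n * x (s i n) \<omega>\<bar>)"
      unfolding R_def using min_sum[OF I]
      by (intro integral_mono integrable_norm int Bochner_Integration.integrable_sum) auto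
    also have "\<dots> = (\<Sum>i\<in>I. expectation (\<lambda>\<omega>. min 1 \<bar>d i n * x (s i n) \<omega>\<bar>))"
      by (intro Bochner_Integration.integral_sum int) auto
    also have "\<dots> = (\<Sum>i\<in>I. expectation (\<lambda>\<omega>. min 1 \<bar>d i n * x 0 \<omega>\<bar>))"
      by (intro sum.cong refl same)
    finally show ?thesis .
  qed
  have "(\<lambda>n. expectation (\<lambda>\<omega>. norm (min 1 \<bar>R n \<omega>\<bar>))) \<longlonglongrightarrow> 0"
    by (rule tendsto_sandwich[OF always_eventually[OF allI] always_eventually[OF allI, OF le] tendsto_const lim]) simp
  then obtain r :: "nat \<Rightarrow> nat" where r: "strict_mono r" "AE \<omega> in M. (\<lambda>n. min 1 \<bar>R (r n) \<omega>\<bar>) \<longlonglongrightarrow> 0"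
    using tendsto_L1_AE_subseq[of M "\<lambda>n \<omega>. min 1 \<bar>R n \<omega>\<bar>"] int by auto
  have "AE \<omega> in M. (\<lambda>n. R (r n) \<omega>) \<longlonglongrightarrow> 0"
    using r(2)
  proof eventually_elim
    case (elim \<omega>)
    have "eventually (\<lambda>n. min 1 \<bar>R (r n) \<omega>\<bar> < 1) sequentially"
      using order_tendstoD(2)[OF elim] by simp
    then have "eventually (\<lambda>n. min 1 \<bar>R (r n) \<omega>\<bar> = \<bar>R (r n) \<omega>\<bar>) sequentially"
      by eventually_elim auto
    then have "(\<lambda>n. \<bar>R (r n) \<omega>\<bar>) \<longlonglongrightarrow> 0"
      using elim by (rule Lim_transform_eventually[rotated])
    then show ?case by (rule tendsto_rabs_zero_cancel)
  qed
  then show ?thesis using r(1) unfolding R_def by blast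
qed

text \<open>Unrolling the recursion along a kernel \<open>h\<close> that inverts the autoregressive filter on \<open>g\<close> turns
  a linear functional of the observations into one of the innovations, up to a remainder that
  stationarity makes negligible; Parseval bounds the energy of \<open>h\<close>.\<close>

lemma (in prob_space) sub_gaussian_ar_window:
  assumes ar: "ar_process M L b u x" and b: "eps_stable \<epsilon> L b" and \<epsilon>: "0 < \<epsilon>" and V: "0 \<le> V"
    and u: "\<And>J. finite J \<Longrightarrow> sub_gaussian M V u J"
  shows "sub_gaussian M (V / \<epsilon>\<^sup>2) (\<lambda>k. x (q - int k)) {..K}"
  unfolding sub_gaussian_def
proof
  fix g :: "nat \<Rightarrow> real"
  let ?a = "ar_coeff L b"
  have stat: "stationary_process M x"
    and rec: "\<And>t. AE \<omega> in M. x t \<omega> = (\<Sum>l=1..L. b l * x (t - int l) \<omega>) + u t \<omega>"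
    using ar by (auto simp: ar_process_def)
  have [measurable]: "x t \<in> borel_measurable M" for t
    using stat by (simp add: stationary_process_def)
  obtain h where h: "h \<longlonglongrightarrow> 0" and hg: "\<And>n. (\<Sum>i\<le>n. ?a i * h (n - i)) = (if n \<le> K then g n else 0)"
    using ar_solution_exists[OF b, of K g] by blast
  \<comment> \<open>The kernel \<open>h\<close> is cut off at \<open>n\<close> to give
    \<open>f n\<close>. Its convolution \<open>c n\<close> with the filter is \<open>g\<close> up to
    \<open>K\<close>, zero from there to \<open>n\<close>, and beyond \<open>n\<close> consists of
    the \<open>L\<close> cut-off errors \<open>d i n\<close>, which vanish as \<open>n\<close>
    grows.\<close>
  define f where "f n k = (if k \<le> n then h k else 0)" for n k :: nat
  define d where "d i n = (\<Sum>j\<in>{i..L}. ?a j * h (n + i - j))" for i n :: nat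
  define c where "c n r = (\<Sum>i\<le>r. ?a i * f n (r - i))" for n r
  have c_le: "c n r = (if r \<le> K then g r else 0)" if "r \<le> n" for n r
  proof -
    have "c n r = (\<Sum>i\<le>r. ?a i * h (r - i))"
      unfolding c_def f_def using that by (intro sum.cong) auto
    then show ?thesis by (simp add: hg)
  qed
  have c_gt: "c n (n + i) = d i n" if "1 \<le> i" "L \<le> n" for n i
    unfolding c_def d_def using that
    by (intro sum.mono_neutral_cong_right) (auto simp: f_def)
  have d_lim: "(\<lambda>n. d i n) \<longlonglongrightarrow> 0" for i
  proof -
    have "(\<lambda>n. h (n + i - j)) \<longlonglongrightarrow> 0" if "j \<in> {i..L}" for j
    proof -
      have "n + i - j = n - (j - i)" for n using that by auto
      then show ?thesis
        using filterlim_compose[OF h filterlim_minus_const_nat_at_top[of "j - i"]] by simp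
    qed
    then have "(\<lambda>n. d i n) \<longlonglongrightarrow> (\<Sum>j\<in>{i..L}. ?a j * 0)"
      unfolding d_def by (intro tendsto_sum tendsto_mult tendsto_const) auto
    then show ?thesis by simp
  qed
  \<comment> \<open>A general \<open>F\<close> serves both uses: the linear functional of the
    observations and the sum of squares in the energy bound.\<close>
  have split: "(\<Sum>r\<le>n + L. F r (c n r)) = (\<Sum>r\<le>K. F r (g r)) + (\<Sum>i=1..L. F (n + i) (d i n))"
    if "K \<le> n" "L \<le> n" and F: "\<And>r. F r 0 = 0" for n and F :: "nat \<Rightarrow> real \<Rightarrow> real"
  proof -
    have "(\<Sum>r\<le>n + L. F r (c n r)) = (\<Sum>r\<le>n. F r (c n r)) + (\<Sum>r\<in>{n+1..n+L}. F r (c n r))"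
      by (subst sum.union_disjoint[symmetric]) (auto intro!: sum.cong)
    also have "(\<Sum>r\<le>n. F r (c n r)) = (\<Sum>r\<le>K. F r (g r))"
      using that by (intro sum.mono_neutral_cong_right) (auto simp: c_le)
    also have "(\<Sum>r\<in>{n+1..n+L}. F r (c n r)) = (\<Sum>i=1..L. F (n + i) (c n (n + i)))"
      using sum.shift_bounds_cl_nat_ivl[of "\<lambda>r. F r (c n r)" 1 n L] by (simp add: add.commute)
    also have "\<dots> = (\<Sum>i=1..L. F (n + i) (d i n))"
      using that by (intro sum.cong) (auto simp: c_gt)
    finally show ?thesis .
  qed
  define Y where "Y \<omega> = (\<Sum>k\<le>K. g k * x (q - int k) \<omega>)" for \<omega>
  define R where "R n \<omega> = (\<Sum>i=1..L. d i n * x (q - int (n + i)) \<omega>)" for n \<omega>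
  have [measurable]: "Y \<in> borel_measurable M" unfolding Y_def by measurable
  have [measurable]: "R n \<in> borel_measurable M" for n unfolding R_def by measurable
  have "AE \<omega> in M. \<forall>t. x t \<omega> = (\<Sum>l=1..L. b l * x (t - int l) \<omega>) + u t \<omega>"
    using rec by (simp add: AE_all_countable)
  then have unroll: "AE \<omega> in M. \<forall>n. K \<le> n \<longrightarrow> L \<le> n \<longrightarrow> (\<Sum>k\<le>n. f n k * u (q - int k) \<omega>) = Y \<omega> + R n \<omega>"
  proof eventually_elim
    case (elim \<omega>)
    have u_eq: "u t \<omega> = (\<Sum>j\<le>L. ?a j * x (t - int j) \<omega>)" for t
      using elim[rule_format, of t] by (simp add: sum_ar_coeff)
    show ?case
    proof (intro allI impI)
      fix n assume n: "K \<le> n" "L \<le> n"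
      have "(\<Sum>k\<le>n. f n k * u (q - int k) \<omega>) = (\<Sum>k\<le>n. f n k * (\<Sum>j\<le>L. ?a j * x (q - int (k + j)) \<omega>))"
        by (simp add: u_eq algebra_simps)
      also have "\<dots> = (\<Sum>r\<le>n + L. c n r * x (q - int r) \<omega>)"
        unfolding c_def by (rule sum_product_shift) (auto simp: f_def)
      also have "\<dots> = Y \<omega> + R n \<omega>"
        unfolding Y_def R_def using n
        by (subst split[OF n, of "\<lambda>r y. y * x (q - int r) \<omega>"]) auto
      finally show "(\<Sum>k\<le>n. f n k * u (q - int k) \<omega>) = Y \<omega> + R n \<omega>" .
    qed
  qed
  define B where "B n = exp (V / 2 * (((\<Sum>k\<le>K. (g k)\<^sup>2) + (\<Sum>i=1..L. (d i n)\<^sup>2)) / \<epsilon>\<^sup>2))" for n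
  have bound: "(\<integral>\<^sup>+\<omega>. ennreal (exp (Y \<omega> + R n \<omega>)) \<partial>M) \<le> ennreal (B n)" if n: "K \<le> n" "L \<le> n" for n
  proof -
    have "sub_gaussian M V (\<lambda>k. u (q - int k)) {..n}"
      by (rule sub_gaussian_reindex[OF u]) (auto simp: inj_on_def)
    then have 1: "(\<integral>\<^sup>+\<omega>. ennreal (exp (\<Sum>k\<le>n. f n k * u (q - int k) \<omega>)) \<partial>M)
        \<le> ennreal (exp (V / 2 * (\<Sum>k\<le>n. (f n k)\<^sup>2)))"
      by (simp add: sub_gaussian_def)
    have 2: "(\<integral>\<^sup>+\<omega>. ennreal (exp (\<Sum>k\<le>n. f n k * u (q - int k) \<omega>)) \<partial>M)
        = (\<integral>\<^sup>+\<omega>. ennreal (exp (Y \<omega> + R n \<omega>)) \<partial>M)"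
      using unroll n by (intro nn_integral_cong_AE) (auto elim!: eventually_mono)
    have "(\<Sum>k\<le>n. (f n k)\<^sup>2) \<le> ((\<Sum>k\<le>K. (g k)\<^sup>2) + (\<Sum>i=1..L. (d i n)\<^sup>2)) / \<epsilon>\<^sup>2"
    proof -
      have "\<epsilon>\<^sup>2 * (\<Sum>k\<le>n. (f n k)\<^sup>2) \<le> (\<Sum>r\<le>n + L. (c n r)\<^sup>2)"
        unfolding c_def by (rule ar_filter_energy[OF b \<epsilon>]) (simp add: f_def)
      also have "\<dots> = (\<Sum>k\<le>K. (g k)\<^sup>2) + (\<Sum>i=1..L. (d i n)\<^sup>2)"
        using n by (rule split) simp
      finally show ?thesis using \<epsilon> by (simp add: field_simps)
    qed
    then have "ennreal (exp (V / 2 * (\<Sum>k\<le>n. (f n k)\<^sup>2))) \<le> ennreal (B n)"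
      unfolding B_def using V by (intro ennreal_leI exp_le_cancel_iff[THEN iffD2] mult_left_mono) auto
    with 1 show ?thesis unfolding 2 by (rule order_trans)
  qed
  have "\<exists>r. strict_mono r \<and> (AE \<omega> in M. (\<lambda>n. R (r n) \<omega>) \<longlonglongrightarrow> 0)"
    unfolding R_def by (rule stationary_remainder_subseq[where d = d and s = "\<lambda>i n. q - int (n + i)", OF stat _ d_lim]) simp
  then obtain r :: "nat \<Rightarrow> nat" where r: "strict_mono r" and R0: "AE \<omega> in M. (\<lambda>n. R (r n) \<omega>) \<longlonglongrightarrow> 0"
    by blast
  have "(\<lambda>n. B n) \<longlonglongrightarrow> exp (V / 2 * (((\<Sum>k\<le>K. (g k)\<^sup>2) + (\<Sum>i=1..L. 0\<^sup>2)) / \<epsilon>\<^sup>2))"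
    unfolding B_def using \<epsilon> by (intro tendsto_intros d_lim) auto
  then have "(\<lambda>n. ennreal (B (r n))) \<longlonglongrightarrow> ennreal (exp (V / \<epsilon>\<^sup>2 / 2 * (\<Sum>k\<le>K. (g k)\<^sup>2)))"
    using LIMSEQ_subseq_LIMSEQ[OF _ r] by (intro tendsto_ennrealI) (auto simp: o_def field_simps)
  then have B_liminf: "liminf (\<lambda>n. ennreal (B (r n))) = ennreal (exp (V / \<epsilon>\<^sup>2 / 2 * (\<Sum>k\<le>K. (g k)\<^sup>2)))"
    by (rule lim_imp_Liminf[rotated]) simp
  \<comment> \<open>Fatou along the subsequence removes the remainder \<open>R\<close> on the left,
    while its energy contribution disappears from the limit of \<open>B\<close>.\<close>
  have "(\<integral>\<^sup>+\<omega>. ennreal (exp (Y \<omega>)) \<partial>M) = (\<integral>\<^sup>+\<omega>. liminf (\<lambda>n. ennreal (exp (Y \<omega> + R (r n) \<omega>))) \<partial>M)"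
  proof (rule nn_integral_cong_AE)
    show "AE \<omega> in M. ennreal (exp (Y \<omega>)) = liminf (\<lambda>n. ennreal (exp (Y \<omega> + R (r n) \<omega>)))"
      using R0
    proof eventually_elim
      case (elim \<omega>)
      have "(\<lambda>n. ennreal (exp (Y \<omega> + R (r n) \<omega>))) \<longlonglongrightarrow> ennreal (exp (Y \<omega> + 0))"
        by (intro tendsto_ennrealI tendsto_intros elim)
      from lim_imp_Liminf[OF _ this] show ?case by simp
    qed
  qed
  also have "\<dots> \<le> liminf (\<lambda>n. \<integral>\<^sup>+\<omega>. ennreal (exp (Y \<omega> + R (r n) \<omega>)) \<partial>M)"
    by (rule nn_integral_liminf) measurable
  also have "\<dots> \<le> liminf (\<lambda>n. ennreal (B (r n)))"
  proof (rule Liminf_mono)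
    show "eventually (\<lambda>n. (\<integral>\<^sup>+\<omega>. ennreal (exp (Y \<omega> + R (r n) \<omega>)) \<partial>M) \<le> ennreal (B (r n))) sequentially"
      using eventually_ge_at_top[of "max K L"]
    proof eventually_elim
      case (elim n)
      then show ?case using seq_suble[OF r, of n] by (intro bound) auto
    qed
  qed
  finally show "(\<integral>\<^sup>+\<omega>. ennreal (exp (\<Sum>k\<le>K. g k * x (q - int k) \<omega>)) \<partial>M)
      \<le> ennreal (exp (V / \<epsilon>\<^sup>2 / 2 * (\<Sum>k\<le>K. (g k)\<^sup>2)))"
    unfolding B_liminf Y_def .
qed

text \<open>A finite set of times fits in a window running backwards from its maximum.\<close>

lemma (in prob_space) sub_gaussian_ar_process:
  assumes "ar_process M L b u x" "eps_stable \<epsilon> L b" "0 < \<epsilon>" "0 \<le> V"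
    and "\<And>J. finite J \<Longrightarrow> sub_gaussian M V u J" and J: "finite J"
  shows "sub_gaussian M (V / \<epsilon>\<^sup>2) x J"
proof (cases "J = {}")
  case True
  then show ?thesis by (simp add: sub_gaussian_def emeasure_space_1)
next
  case False
  define K where "K = nat (Max J - Min J)"
  have J_le: "t \<le> Max J" "Min J \<le> t" if "t \<in> J" for t using that J by auto
  define f where "f t = nat (Max J - t)" for t
  have "sub_gaussian M (V / \<epsilon>\<^sup>2) (\<lambda>k. x (Max J - int k)) {..K}"
    by (rule sub_gaussian_ar_window) (use assms in auto)
  moreover have "f ` J \<subseteq> {..K}" using J_le(2) by (auto simp: f_def K_def intro!: nat_mono)
  ultimately have "sub_gaussian M (V / \<epsilon>\<^sup>2) (\<lambda>k. x (Max J - int k)) (f ` J)"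
    by (rule sub_gaussian_subset) simp
  moreover have "inj_on f J" using J_le by (auto simp: inj_on_def f_def eq_nat_nat_iff)
  ultimately have "sub_gaussian M (V / \<epsilon>\<^sup>2) (\<lambda>t. x (Max J - int (f t))) J"
    by (rule sub_gaussian_reindex)
  moreover have "Max J - int (f t) = t" if "t \<in> J" for t using J_le(1)[OF that] by (simp add: f_def)
  ultimately show ?thesis by (simp add: sub_gaussian_def cong: sum.cong)
qed

section \<open>Tails of sums of products\<close>

text \<open>The weights \<open>\<epsilon>\<close> and \<open>1 / \<epsilon>\<close> equalise the two variance proxies, and the factor \<open>3 / 8\<close> makes the
  bound for each sum of squares equal to \<open>2\<close> per summand.\<close>

lemma (in prob_space) sub_gaussian_exp_abs_sum_product:
  fixes X Y :: "'i \<Rightarrow> 'a \<Rightarrow> real"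
  assumes J: "finite J" and \<sigma>: "0 < \<sigma>" and \<epsilon>: "0 < \<epsilon>"
    and X[measurable]: "\<And>i. X i \<in> borel_measurable M" and Y[measurable]: "\<And>i. Y i \<in> borel_measurable M"
    and sgX: "sub_gaussian M (\<sigma>\<^sup>2 / \<epsilon>\<^sup>2) X J" and sgY: "sub_gaussian M (\<sigma>\<^sup>2) Y J"
  shows "(\<integral>\<^sup>+\<omega>. ennreal (exp (3 * \<epsilon> / (8 * \<sigma>\<^sup>2) * \<bar>\<Sum>i\<in>J. X i \<omega> * Y i \<omega>\<bar>)) \<partial>M) \<le> ennreal (2 ^ card J)"
proof -
  define s t where "s = 3 * \<epsilon>\<^sup>2 / (8 * \<sigma>\<^sup>2)" and "t = 3 / (8 * \<sigma>\<^sup>2)"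
  have sV: "s * (\<sigma>\<^sup>2 / \<epsilon>\<^sup>2) = 3 / 8" "t * \<sigma>\<^sup>2 = 3 / 8" "0 \<le> s" "0 \<le> t"
    using \<sigma> \<epsilon> by (simp_all add: s_def t_def)
  have half: "1 / sqrt (1 - 2 * (3 / 8)) = (2 :: real)"
  proof -
    have "1 - 2 * (3 / 8) = (1 / 2 :: real)\<^sup>2" by (simp add: power2_eq_square)
    then show ?thesis by (simp only: real_sqrt_abs) simp
  qed
  have EX: "(\<integral>\<^sup>+\<omega>. ennreal (exp (s * (\<Sum>i\<in>J. (X i \<omega>)\<^sup>2))) \<partial>M) \<le> ennreal (2 ^ card J)"
    using sub_gaussian_exp_sum_squares[OF J X sgX, of s] unfolding sV(1) half by (simp add: sV)
  have EY: "(\<integral>\<^sup>+\<omega>. ennreal (exp (t * (\<Sum>i\<in>J. (Y i \<omega>)\<^sup>2))) \<partial>M) \<le> ennreal (2 ^ card J)"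
    using sub_gaussian_exp_sum_squares[OF J Y sgY, of t] unfolding sV(2) half by (simp add: sV)
  \<comment> \<open>No independence between \<open>X\<close> and \<open>Y\<close> is assumed, so
    \<open>exp ((A + B) / 2)\<close> is replaced by the average of \<open>exp A\<close> and
    \<open>exp B\<close>, whose expectations are bounded separately.\<close>
  have pointwise: "exp (3 * \<epsilon> / (8 * \<sigma>\<^sup>2) * \<bar>\<Sum>i\<in>J. X i \<omega> * Y i \<omega>\<bar>)
      \<le> (exp (s * (\<Sum>i\<in>J. (X i \<omega>)\<^sup>2)) + exp (t * (\<Sum>i\<in>J. (Y i \<omega>)\<^sup>2))) / 2" (is "_ \<le> (exp ?A + exp ?B) / 2") for \<omega>
  proof -
    have "\<bar>\<Sum>i\<in>J. X i \<omega> * Y i \<omega>\<bar> \<le> (\<Sum>i\<in>J. \<epsilon> / 2 * (X i \<omega>)\<^sup>2 + 1 / (2 * \<epsilon>) * (Y i \<omega>)\<^sup>2)"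
    proof (rule order_trans[OF sum_abs sum_mono])
      fix i
      have "0 \<le> (\<epsilon> * \<bar>X i \<omega>\<bar> - \<bar>Y i \<omega>\<bar>)\<^sup>2" by simp
      then have "2 * \<epsilon> * \<bar>X i \<omega> * Y i \<omega>\<bar> \<le> \<epsilon>\<^sup>2 * (X i \<omega>)\<^sup>2 + (Y i \<omega>)\<^sup>2"
        by (simp add: power2_diff power_mult_distrib abs_mult mult_ac)
      then show "\<bar>X i \<omega> * Y i \<omega>\<bar> \<le> \<epsilon> / 2 * (X i \<omega>)\<^sup>2 + 1 / (2 * \<epsilon>) * (Y i \<omega>)\<^sup>2"
        using \<epsilon> by (simp add: field_simps power2_eq_square)
    qed
    also have "\<dots> = \<epsilon> / 2 * (\<Sum>i\<in>J. (X i \<omega>)\<^sup>2) + 1 / (2 * \<epsilon>) * (\<Sum>i\<in>J. (Y i \<omega>)\<^sup>2)"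
      by (simp only: sum.distrib sum_distrib_left)
    finally have "3 * \<epsilon> / (8 * \<sigma>\<^sup>2) * \<bar>\<Sum>i\<in>J. X i \<omega> * Y i \<omega>\<bar>
        \<le> 3 * \<epsilon> / (8 * \<sigma>\<^sup>2) * (\<epsilon> / 2 * (\<Sum>i\<in>J. (X i \<omega>)\<^sup>2) + 1 / (2 * \<epsilon>) * (\<Sum>i\<in>J. (Y i \<omega>)\<^sup>2))"
      using \<epsilon> by (intro mult_left_mono) auto
    also have "\<dots> = ?A / 2 + ?B / 2"
      using \<epsilon> \<sigma> by (simp add: s_def t_def distrib_left power2_eq_square)
    finally have "exp (3 * \<epsilon> / (8 * \<sigma>\<^sup>2) * \<bar>\<Sum>i\<in>J. X i \<omega> * Y i \<omega>\<bar>) \<le> exp (?A / 2) * exp (?B / 2)"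
      by (simp add: exp_add[symmetric])
    also have "\<dots> \<le> ((exp (?A / 2))\<^sup>2 + (exp (?B / 2))\<^sup>2) / 2"
      using sum_squares_bound[of "exp (?A / 2)" "exp (?B / 2)"] by simp
    also have "\<dots> = (exp ?A + exp ?B) / 2"
      by (simp add: exp_double[symmetric])
    finally show ?thesis .
  qed
  have average: "ennreal (1 / 2) * (ennreal p + ennreal q) = ennreal ((p + q) / 2)"
    if "0 \<le> p" "0 \<le> q" for p q
  proof -
    have "ennreal (1 / 2) * ennreal (p + q) = ennreal (1 / 2 * (p + q))"
      using that by (intro ennreal_mult[symmetric]) auto
    then show ?thesis using that by (simp only: ennreal_plus) simp
  qed
  have "(\<integral>\<^sup>+\<omega>. ennreal (exp (3 * \<epsilon> / (8 * \<sigma>\<^sup>2) * \<bar>\<Sum>i\<in>J. X i \<omega> * Y i \<omega>\<bar>)) \<partial>M)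
      \<le> (\<integral>\<^sup>+\<omega>. ennreal (1 / 2) * (ennreal (exp (s * (\<Sum>i\<in>J. (X i \<omega>)\<^sup>2)))
            + ennreal (exp (t * (\<Sum>i\<in>J. (Y i \<omega>)\<^sup>2)))) \<partial>M)"
    by (intro nn_integral_mono) (simp only: average exp_ge_zero ennreal_leI[OF pointwise])
  also have "\<dots> = ennreal (1 / 2) * ((\<integral>\<^sup>+\<omega>. ennreal (exp (s * (\<Sum>i\<in>J. (X i \<omega>)\<^sup>2))) \<partial>M)
            + (\<integral>\<^sup>+\<omega>. ennreal (exp (t * (\<Sum>i\<in>J. (Y i \<omega>)\<^sup>2))) \<partial>M))"
    by (subst nn_integral_cmult) (simp_all add: nn_integral_add)
  also have "\<dots> \<le> ennreal (1 / 2) * (ennreal (2 ^ card J) + ennreal (2 ^ card J))"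
    using EX EY by (intro mult_left_mono add_mono) auto
  also have "\<dots> = ennreal (2 ^ card J)"
    by (subst average) simp_all
  finally show ?thesis .
qed

text \<open>Exponential Markov inequality at a fixed rate. The factor \<open>2 ^ card J\<close> is
  harmless in the application, where the level \<open>a\<close> is large compared with the number of
  summands.\<close>

lemma (in prob_space) prob_abs_sum_product_ge:
  fixes X Y :: "'i \<Rightarrow> 'a \<Rightarrow> real"
  assumes J: "finite J" and \<sigma>: "0 < \<sigma>" and \<epsilon>: "0 < \<epsilon>"
    and X[measurable]: "\<And>i. X i \<in> borel_measurable M" and Y[measurable]: "\<And>i. Y i \<in> borel_measurable M"
    and sgX: "sub_gaussian M (\<sigma>\<^sup>2 / \<epsilon>\<^sup>2) X J" and sgY: "sub_gaussian M (\<sigma>\<^sup>2) Y J"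
  shows "prob {\<omega> \<in> space M. a \<le> \<bar>\<Sum>i\<in>J. X i \<omega> * Y i \<omega>\<bar>}
           \<le> 2 ^ card J * exp (- (3 * \<epsilon> / (8 * \<sigma>\<^sup>2) * a))"
proof -
  define \<kappa> where "\<kappa> = 3 * \<epsilon> / (8 * \<sigma>\<^sup>2)"
  have \<kappa>: "0 < \<kappa>" using \<sigma> \<epsilon> by (simp add: \<kappa>_def)
  let ?u = "\<lambda>\<omega>. ennreal (exp (\<kappa> * \<bar>\<Sum>i\<in>J. X i \<omega> * Y i \<omega>\<bar>))"
  have "{\<omega> \<in> space M. a \<le> \<bar>\<Sum>i\<in>J. X i \<omega> * Y i \<omega>\<bar>} = {\<omega> \<in> space M. 1 \<le> ennreal (exp (- (\<kappa> * a))) * ?u \<omega>}"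
    using \<kappa> by (auto simp: ennreal_mult[symmetric] exp_add[symmetric] mult_le_cancel_left)
  then have "emeasure M {\<omega> \<in> space M. a \<le> \<bar>\<Sum>i\<in>J. X i \<omega> * Y i \<omega>\<bar>}
      \<le> ennreal (exp (- (\<kappa> * a))) * (\<integral>\<^sup>+\<omega>. ?u \<omega> * indicator (space M) \<omega> \<partial>M)"
    by (simp only:) (rule nn_integral_Markov_inequality; measurable)
  also have "(\<integral>\<^sup>+\<omega>. ?u \<omega> * indicator (space M) \<omega> \<partial>M) = (\<integral>\<^sup>+\<omega>. ?u \<omega> \<partial>M)"
    by (intro nn_integral_cong) simp
  also have "ennreal (exp (- (\<kappa> * a))) * (\<integral>\<^sup>+\<omega>. ?u \<omega> \<partial>M) \<le> ennreal (exp (- (\<kappa> * a))) * ennreal (2 ^ card J)"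
    unfolding \<kappa>_def by (intro mult_left_mono sub_gaussian_exp_abs_sum_product assms) auto
  also have "\<dots> = ennreal (2 ^ card J * exp (- (\<kappa> * a)))"
    by (simp add: ennreal_mult[symmetric] mult.commute)
  finally show ?thesis
    unfolding \<kappa>_def emeasure_eq_measure by (subst (asm) ennreal_le_iff) auto
qed

section \<open>The union bound over processes and lags\<close>

lemma transpose_mult_design_matrix:
  assumes "m \<in> {1..M}"
  shows "transpose_mult (sample_index M T) (design_matrix X \<omega>) (noise_vector U \<omega>) m l
           = (\<Sum>t=1..T m. X m (int t - int l) \<omega> * U m (int t) \<omega>)"
proof -
  have "transpose_mult (sample_index M T) (design_matrix X \<omega>) (noise_vector U \<omega>) m l
      = (\<Sum>(k, t)\<in>(SIGMA k:{1..M}. {1..T k}). (if k = m then X k (int t - int l) \<omega> else 0) * U k (int t) \<omega>)"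
    unfolding transpose_mult_def sample_index_def
    by (intro sum.cong) (auto simp: design_matrix_def noise_vector_def lag_matrix_def)
  also have "\<dots> = (\<Sum>k=1..M. if k = m then (\<Sum>t=1..T k. X k (int t - int l) \<omega> * U k (int t) \<omega>) else 0)"
    by (subst sum.Sigma[symmetric], simp, simp, rule sum.cong[OF refl]) simp
  also have "\<dots> = (\<Sum>t=1..T m. X m (int t - int l) \<omega> * U m (int t) \<omega>)"
    using assms by simp
  finally show ?thesis .
qed

text \<open>With \<open>e = 1 / \<epsilon>\<close> the claim is
  \<open>3e \<le> 1 + e^2 + e^4\<close>, whose two sides differ by
  \<open>(e^2 - 1)^2 + 3(e^2 - e)\<close>. It compensates the factor \<open>\<epsilon>\<close> in
  the exponential rate.\<close>

lemma three_le_one_plus_powi: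
  assumes "0 < \<epsilon>" "\<epsilon> < (1::real)"
  shows "3 \<le> \<epsilon> * (1 + \<epsilon> powi (-2) + \<epsilon> powi (-4))"
proof -
  define e where "e = 1 / \<epsilon>"
  have e: "1 < e" and \<epsilon>: "\<epsilon> = 1 / e" using assms by (simp_all add: e_def)
  have "3 * e \<le> 1 + e\<^sup>2 + e ^ 4"
  proof -
    have "1 + e\<^sup>2 + e ^ 4 - 3 * e = (e\<^sup>2 - 1)\<^sup>2 + 3 * (e\<^sup>2 - e)"
      by (simp add: power2_eq_square power4_eq_xxxx algebra_simps)
    moreover have "e \<le> e\<^sup>2" using e by (simp add: power2_eq_square)
    then have "0 \<le> (e\<^sup>2 - 1)\<^sup>2 + 3 * (e\<^sup>2 - e)"
      by (intro add_nonneg_nonneg) auto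
    ultimately have "0 \<le> 1 + e\<^sup>2 + e ^ 4 - 3 * e" by (simp only:)
    then show ?thesis by simp
  qed
  moreover have eq: "1 + \<epsilon> powi (-2) + \<epsilon> powi (-4) = 1 + e\<^sup>2 + e ^ 4"
    using e unfolding \<epsilon> by (simp add: power_int_minus power_divide)
  ultimately show ?thesis using e unfolding eq by (simp add: \<epsilon> le_divide_eq)
qed

theorem theorem4p3:
  fixes P :: "'a measure"
    and X U :: "nat \<Rightarrow> int \<Rightarrow> 'a \<Rightarrow> real"
    and \<beta> :: "nat \<Rightarrow> nat \<Rightarrow> real"
    and \<sigma> :: "nat \<Rightarrow> real"
    and T :: "nat \<Rightarrow> nat"
    and M L L\<^sub>0 D :: nat
    and \<epsilon> \<eta> \<delta> c\<^sub>0 \<sigma>\<^sub>m\<^sub>a\<^sub>x C\<^sub>s\<^sub>h\<^sub>a\<^sub>r\<^sub>p :: real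
  assumes P: "prob_space P"
    and M: "M \<ge> 1"
    and L: "1 \<le> L\<^sub>0" "L\<^sub>0 \<le> L"
    and \<epsilon>: "0 < \<epsilon>" "\<epsilon> < 1"
    and true_lag: "\<And>m. m \<in> {1..M} \<Longrightarrow> \<beta> m L\<^sub>0 \<noteq> 0"
      "\<And>m l. m \<in> {1..M} \<Longrightarrow> L\<^sub>0 < l \<Longrightarrow> l \<le> L \<Longrightarrow> \<beta> m l = 0"
    and ar: "\<And>m. m \<in> {1..M} \<Longrightarrow> ar_process P L (\<beta> m) (U m) (X m)"
    and stable: "\<And>m. m \<in> {1..M} \<Longrightarrow> eps_stable \<epsilon> L (\<beta> m)"
    and \<sigma>_pos: "\<And>m. m \<in> {1..M} \<Longrightarrow> 0 < \<sigma> m"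
    and U_gauss: "\<And>m t. m \<in> {1..M} \<Longrightarrow> distributed P lborel (U m t) (normal_density 0 (\<sigma> m))"
    and U_indep: "prob_space.indep_vars P (\<lambda>_. borel) (\<lambda>(m, t). U m t) ({1..M} \<times> (UNIV :: int set))"
    and T: "\<And>m. m \<in> {1..M} \<Longrightarrow> T m \<ge> 1"
    and D_def: "D = (\<Sum>m=1..M. T m)"
    and \<sigma>_max_def: "\<sigma>\<^sub>m\<^sub>a\<^sub>x = Max (\<sigma> ` {1..M})"
    and C_sharp_def: "C\<^sub>s\<^sub>h\<^sub>a\<^sub>r\<^sub>p = real (Max (T ` {1..M})) / real (Min (T ` {1..M}))"
    and c0: "gaussian_concentration_constant c\<^sub>0"
    and \<eta>_pos: "\<eta> > 0"
    and \<eta>: "\<eta> \<ge> 8 * C\<^sub>s\<^sub>h\<^sub>a\<^sub>r\<^sub>p * \<sigma>\<^sub>m\<^sub>a\<^sub>x\<^sup>2 * (1 + \<epsilon> powi (-2) + \<epsilon> powi (-4)) / real M"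
    and \<delta>: "\<delta> > 0"
    and D: "real D \<ge> 8 * \<sigma>\<^sub>m\<^sub>a\<^sub>x\<^sup>2 * (1 + \<epsilon> powi (-2) + \<epsilon> powi (-4)) / (c\<^sub>0 * \<eta>)
                      * ln (real M * real L / \<delta>)"
  shows "\<P>(\<omega> in P. 2 / real D *
            dual_group_norm M L
              (transpose_mult (sample_index M T) (design_matrix X \<omega>) (noise_vector U \<omega>))
            \<ge> 3 * \<eta> / (2 * sqrt (real L))) \<le> \<delta>"
proof -
  interpret prob_space P by (rule P)
  define K where "K = 1 + \<epsilon> powi (-2) + \<epsilon> powi (-4)"
  define y where "y = real D * \<eta> / (8 * \<sigma>\<^sub>m\<^sub>a\<^sub>x\<^sup>2 * K)"
  \<comment> \<open>Chosen so that \<open>2 / D * (2 * a / sqrt L)\<close> equals the threshold of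
    the theorem.\<close>
  define a where "a = 3 * \<eta> * real D / 8"
  define v where "v m l \<omega> = (\<Sum>t=1..T m. X m (int t - int l) \<omega> * U m (int t) \<omega>)" for m l \<omega>
  define E where "E m l = {\<omega> \<in> space P. a \<le> \<bar>v m l \<omega>\<bar>}" for m l

  have L1: "1 \<le> L" using L by simp
  have K: "3 \<le> \<epsilon> * K" unfolding K_def by (rule three_le_one_plus_powi[OF \<epsilon>])
  then have K0: "0 < K" using \<epsilon> by (metis less_le_trans zero_less_mult_pos zero_less_numeral)
  have \<sigma>_le: "\<sigma> m \<le> \<sigma>\<^sub>m\<^sub>a\<^sub>x" if "m \<in> {1..M}" for m
    unfolding \<sigma>_max_def using that by (intro Max_ge) auto
  have \<sigma>0: "0 < \<sigma>\<^sub>m\<^sub>a\<^sub>x" using \<sigma>_pos[of 1] \<sigma>_le[of 1] M by simp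
  have c0': "0 < c\<^sub>0" "c\<^sub>0 \<le> 9 / 4"
    using c0 gaussian_concentration_constant_le[OF c0] by (auto simp: gaussian_concentration_constant_def)

  \<comment> \<open>From \<open>D \<ge> M * Tmin\<close> and the lower bound on
    \<open>\<eta>\<close>, the factors \<open>M\<close> and \<open>Tmin\<close> cancel in
    \<open>D * \<eta>\<close> and leave \<open>Tmax\<close>. Thus \<open>y\<close> dominates every
    sample size.\<close>
  have T_le: "real (T m) \<le> y" if m: "m \<in> {1..M}" for m
  proof -
    define Tmin Tmax where "Tmin = Min (T ` {1..M})" and "Tmax = Max (T ` {1..M})"
    have "Tmin \<in> T ` {1..M}" unfolding Tmin_def using m by (intro Min_in) auto
    then have Tmin: "1 \<le> Tmin" using T by auto
    have "of_nat (card {1..M}) * Tmin \<le> (\<Sum>m=1..M. T m)"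
      by (rule sum_bounded_below) (simp add: Tmin_def)
    then have D_ge: "real M * real Tmin \<le> real D"
      unfolding D_def by (simp flip: of_nat_mult of_nat_sum)
    have "8 * real Tmax * \<sigma>\<^sub>m\<^sub>a\<^sub>x\<^sup>2 * K = (real M * real Tmin) * (8 * C\<^sub>s\<^sub>h\<^sub>a\<^sub>r\<^sub>p * \<sigma>\<^sub>m\<^sub>a\<^sub>x\<^sup>2 * K / real M)"
      unfolding C_sharp_def Tmin_def[symmetric] Tmax_def[symmetric] using Tmin M by simp
    also have "\<dots> \<le> real D * \<eta>"
      using D_ge \<eta> K0 by (intro mult_mono) (auto simp: K_def C_sharp_def)
    finally have "real Tmax \<le> y"
      using \<sigma>0 K0 by (simp add: y_def pos_le_divide_eq mult_ac)
    moreover have "T m \<le> Tmax" unfolding Tmax_def using m by (intro Max_ge) auto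
    ultimately show ?thesis by linarith
  qed
  have y1: "1 \<le> y" using T_le[of 1] T[of 1] M by simp
  have D0: "0 < real D"
  proof -
    have "T 1 \<le> D" unfolding D_def using M by (intro member_le_sum) auto
    then show ?thesis using T[of 1] M by simp
  qed

  have X_meas: "X m t \<in> borel_measurable P" if "m \<in> {1..M}" for m t
    using ar[OF that] by (simp add: ar_process_def stationary_process_def)
  have U_meas: "U m t \<in> borel_measurable P" if "m \<in> {1..M}" for m t
    using distributed_measurable[OF U_gauss[OF that, of t]] by simp
  have sgU: "sub_gaussian P ((\<sigma> m)\<^sup>2) (U m) J" if m: "m \<in> {1..M}" and J: "finite J" for m J
  proof -
    have "sub_gaussian P ((\<sigma> m)\<^sup>2) (\<lambda>(m, t). U m t) (Pair m ` J)"
    proof (rule sub_gaussian_indep_normal)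
      show "indep_vars (\<lambda>_. borel) (\<lambda>(m, t). U m t) (Pair m ` J)"
        using U_indep by (rule indep_vars_subset) (use m in auto)
    qed (use J m \<sigma>_pos U_gauss in auto)
    from sub_gaussian_reindex[OF this] show ?thesis by (simp add: inj_on_def)
  qed
  have sgX: "sub_gaussian P ((\<sigma> m)\<^sup>2 / \<epsilon>\<^sup>2) (X m) J" if m: "m \<in> {1..M}" and J: "finite J" for m J
    using ar[OF m] stable[OF m] \<epsilon>(1) _ sgU[OF m] J by (rule sub_gaussian_ar_process) simp_all

  have prob_E: "prob (E m l) \<le> \<delta> / (real M * real L)" and E_sets: "E m l \<in> events"
    if m: "m \<in> {1..M}" for m l
  proof -
    note [measurable] = X_meas[OF m] U_meas[OF m]
    show "E m l \<in> events" unfolding E_def v_def by measurable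
    have two: "2 ^ card {1..T m} \<le> exp y"
    proof -
      have "(2::real) ^ T m \<le> exp 1 ^ T m"
        using exp_ge_add_one_self[of "1::real"] by (intro power_mono) auto
      also have "\<dots> = exp (real (T m))" by (simp add: exp_of_nat_mult[symmetric])
      also have "\<dots> \<le> exp y" using T_le[OF m] by simp
      finally show ?thesis by simp
    qed
    \<comment> \<open>The exponent is \<open>9/8 * y\<close> times \<open>\<epsilon> * K\<close> and
      a variance ratio; these two factors are at least 3 and 1.\<close>
    have lam: "exp (- (3 * \<epsilon> / (8 * (\<sigma> m)\<^sup>2) * a)) \<le> exp (- (27 / 8 * y))"
    proof -
      have "(\<sigma> m)\<^sup>2 \<le> \<sigma>\<^sub>m\<^sub>a\<^sub>x\<^sup>2"
        using \<sigma>_le[OF m] \<sigma>_pos[OF m] by (intro power_mono) auto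
      then have r: "1 \<le> \<sigma>\<^sub>m\<^sub>a\<^sub>x\<^sup>2 / (\<sigma> m)\<^sup>2" using \<sigma>_pos[OF m] by simp
      have a_y: "a = 3 * \<sigma>\<^sub>m\<^sub>a\<^sub>x\<^sup>2 * K * y" using \<sigma>0 K0 by (simp add: a_def y_def)
      have "27 / 8 * y = 9 / 8 * (3 * 1) * y" by simp
      also have "\<dots> \<le> 9 / 8 * ((\<epsilon> * K) * (\<sigma>\<^sub>m\<^sub>a\<^sub>x\<^sup>2 / (\<sigma> m)\<^sup>2)) * y"
        using K r y1 by (intro mult_right_mono mult_left_mono mult_mono) auto
      also have "\<dots> = 3 * \<epsilon> / (8 * (\<sigma> m)\<^sup>2) * a"
        by (simp add: a_y)
      finally show ?thesis by simp
    qed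
    have "prob (E m l) \<le> 2 ^ card {1..T m} * exp (- (3 * \<epsilon> / (8 * (\<sigma> m)\<^sup>2) * a))"
      unfolding E_def v_def
    proof (rule prob_abs_sum_product_ge)
      show "sub_gaussian P ((\<sigma> m)\<^sup>2 / \<epsilon>\<^sup>2) (\<lambda>t. X m (int t - int l)) {1..T m}"
        by (rule sub_gaussian_reindex[OF sgX[OF m]]) (auto simp: inj_on_def)
      show "sub_gaussian P ((\<sigma> m)\<^sup>2) (\<lambda>t. U m (int t)) {1..T m}"
        by (rule sub_gaussian_reindex[OF sgU[OF m]]) (auto simp: inj_on_def)
    qed (use \<sigma>_pos[OF m] \<epsilon> in auto)
    also have "\<dots> \<le> exp y * exp (- (27 / 8 * y))"
      using two lam by (intro mult_mono) auto
    \<comment> \<open>The exponents combine to \<open>- 19/8 * y\<close>, and \<open>19/8\<close>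
      exceeds the bound 9/4 on the concentration constant.\<close>
    also have "\<dots> \<le> exp (- c\<^sub>0 * y)"
    proof -
      have "c\<^sub>0 * y \<le> 9 / 4 * y" using c0' y1 by (intro mult_right_mono) auto
      then show ?thesis using y1 by (simp add: exp_add[symmetric])
    qed
    also have "\<dots> \<le> \<delta> / (real M * real L)"
    proof -
      have pos: "0 < real M * real L / \<delta>" using M L1 \<delta> by simp
      have "ln (real M * real L / \<delta>) \<le> c\<^sub>0 * y"
        using D c0' \<sigma>0 K0 \<eta>_pos unfolding K_def[symmetric] y_def by (simp add: field_simps)
      then have "exp (- c\<^sub>0 * y) \<le> exp (- ln (real M * real L / \<delta>))" by simp
      also have "\<dots> = \<delta> / (real M * real L)" using pos by (simp add: exp_minus)
      finally show ?thesis .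
    qed
    finally show "prob (E m l) \<le> \<delta> / (real M * real L)" .
  qed

  let ?v = "\<lambda>\<omega>. transpose_mult (sample_index M T) (design_matrix X \<omega>) (noise_vector U \<omega>)"
  have subset: "{\<omega> \<in> space P. 3 * \<eta> / (2 * sqrt (real L)) \<le> 2 / real D * dual_group_norm M L (?v \<omega>)}
      \<subseteq> (\<Union>(m, l)\<in>{1..M} \<times> {1..L}. E m l)"
  \<comment> \<open>Outside the union the largest of the finitely many entries is strictly below
    \<open>a\<close>; this strictness is needed because the event on the left has a non-strict
    inequality.\<close>
  proof (rule subsetI, rule ccontr)
    fix \<omega>
    assume \<omega>: "\<omega> \<in> {\<omega> \<in> space P. 3 * \<eta> / (2 * sqrt (real L)) \<le> 2 / real D * dual_group_norm M L (?v \<omega>)}"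
      and not: "\<omega> \<notin> (\<Union>(m, l)\<in>{1..M} \<times> {1..L}. E m l)"
    define B where "B = Max ((\<lambda>(m, l). \<bar>v m l \<omega>\<bar>) ` ({1..M} \<times> {1..L}))"
    have v_le: "\<bar>v m l \<omega>\<bar> \<le> B" if "m \<in> {1..M}" "l \<in> {1..L}" for m l
      unfolding B_def using that by (intro Max_ge) auto
    have "B \<in> (\<lambda>(m, l). \<bar>v m l \<omega>\<bar>) ` ({1..M} \<times> {1..L})"
      unfolding B_def using M L1 by (intro Max_in) auto
    then have "B < a" "0 \<le> B" using \<omega> not by (force simp: E_def not_le)+
    have "dual_group_norm M L (?v \<omega>) \<le> 2 * B / sqrt (real L)"
      using L1 v_le \<open>0 \<le> B\<close> by (intro dual_group_norm_le) (auto simp: transpose_mult_design_matrix v_def)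
    also have "\<dots> < 2 * a / sqrt (real L)"
      using \<open>B < a\<close> L1 by (simp add: divide_strict_right_mono)
    finally have "2 / real D * dual_group_norm M L (?v \<omega>) < 2 / real D * (2 * a / sqrt (real L))"
      using D0 by (intro mult_strict_left_mono) auto
    also have "\<dots> = 3 * \<eta> / (2 * sqrt (real L))" using D0 by (simp add: a_def)
    finally show False using \<omega> by simp
  qed
  have "\<P>(\<omega> in P. 3 * \<eta> / (2 * sqrt (real L)) \<le> 2 / real D * dual_group_norm M L (?v \<omega>))
      \<le> prob (\<Union>(m, l)\<in>{1..M} \<times> {1..L}. E m l)"
    using subset by (rule finite_measure_mono) (auto intro!: sets.finite_UN E_sets)
  also have "\<dots> \<le> (\<Sum>(m, l)\<in>{1..M} \<times> {1..L}. prob (E m l))"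
    using finite_measure_subadditive_finite[of "{1..M} \<times> {1..L}" "\<lambda>(m, l). E m l"] E_sets
    by (auto simp: case_prod_unfold image_subset_iff)
  also have "\<dots> \<le> (\<Sum>(m, l)\<in>{1..M} \<times> {1..L}. \<delta> / (real M * real L))"
    using prob_E by (intro sum_mono) auto
  also have "\<dots> = \<delta>" using M L1 by simp
  finally show ?thesis .
qed

end
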